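(* Let $K\subseteq\mathbb{R}^n$ be a compact convex subset with non-empty interior. Let $F$ be a locally convex space, $U\subseteq F$ a convex subset with non-empty interior, $r\in\mathbb{N}\cup\{\infty\}$, and $f\colon U\times K\to K$ a $C^r$-map such that $f_z:=f(z,\cdot)\in\operatorname{Diff}^{C^r}_{\partial K}(K)$ for all $z\in U$. Then also the following map is $C^r$: $$g\colon U\times K\to K,\quad (z,y)\mapsto (f_z)^{-1}(y).$$
   Context: All locally convex spaces are real and Hausdorff; $\mathbb{N}=\{1,2,\dots\}$. $C^r$-maps (Bastiani/Keller $C^r_c$). Let $E,F$ be locally convex spaces, $r\in\mathbb{N}_0\cup\{\infty\}$. For $U\subseteq E$ open, $f\colon U\to F$ is $C^r$ if it is continuous, the iterated directional derivatives $d^{(k)}f(x,y_1,\dots,y_k)=(D_{y_k}\cdots D_{y_1}f)(x)$ exist for all $k\in\mathbb{N}$, $k\le r$, $x\in U$, $y_i\in E$, and all $d^{(k)}f\colon U\times E^k\to F$ are continuous. If $U\subseteq E$ is a subset with dense interior $U^0$ that is locally convex (every $x\in U$ has a convex neighbourhood in $U$; e.g. a convex set with non-empty interior), then $f\colon U\to F$ is $C^r$ if $f$ is continuous, $f|_{U^0}$ is $C^r$ and each $d^{(k)}(f|_{U^0})$ ($k\le r$) has a continuous extension to $U\times E^k\to F$. A map into $K\subseteq\mathbb{R}^n$ is $C^r$ if it is $C^r$ as a map into $\mathbb{R}^n$. $\operatorname{Diff}^{C^r}_{\partial K}(K)$ is the group of all bijections $\phi\colon K\to K$ such that $\phi$ and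 $\phi^{-1}$ are $C^r$ and $\phi(x)=x$ for all $x\in\partial K$. *)

theory Defs
  imports "HOL-Analysis.Analysis" "HOL-Library.Extended_Nat"
begin

section \<open>Locally convex spaces\<close>

text \<open>Real Hausdorff locally convex topological vector spaces. The last axiom spells out
  \<^const>\<open>convex\<close>, which is not available inside a class specification.
  The class does not extend \<^class>\<open>topological_ab_group_add\<close> since the library provides products of
  the latter only for normed spaces.\<close>

class locally_convex_space = real_vector + t2_space +
  assumes tendsto_add_nhds_prod:
    "((\<lambda>p. fst p + snd p) \<longlongrightarrow> x + y) (nhds x \<times>\<^sub>F nhds y)"
  and tendsto_scaleR_nhds_prod:
    "((\<lambda>p. fst p *\<^sub>R snd p) \<longlongrightarrow> a *\<^sub>R x) (nhds a \<times>\<^sub>F nhds x)"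
  and ex_open_convex_subset_raw:
    "open S \<Longrightarrow> x \<in> S \<Longrightarrow> \<exists>V. open V \<and>
       (\<forall>v\<in>V. \<forall>w\<in>V. \<forall>s\<ge>0. \<forall>t\<ge>0. s + t = 1 \<longrightarrow> s *\<^sub>R v + t *\<^sub>R w \<in> V) \<and> x \<in> V \<and> V \<subseteq> S"

lemma ex_open_convex_subset:
  fixes S :: "'a::locally_convex_space set"
  shows "open S \<Longrightarrow> x \<in> S \<Longrightarrow> \<exists>V. open V \<and> convex V \<and> x \<in> V \<and> V \<subseteq> S"
  unfolding convex_def by (rule ex_open_convex_subset_raw)

instance real_normed_vector \<subseteq> locally_convex_space
proof
  fix x y :: 'a
  show "((\<lambda>p. fst p + snd p) \<longlongrightarrow> x + y) (nhds x \<times>\<^sub>F nhds y)"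
    by (rule tendsto_add_Pair)
next
  fix a :: real and x :: 'a
  have "((\<lambda>p. fst p *\<^sub>R snd p) \<longlongrightarrow> fst (a, x) *\<^sub>R snd (a, x)) (nhds (a, x))"
    by (intro tendsto_intros filterlim_ident)
  then show "((\<lambda>p. fst p *\<^sub>R snd p) \<longlongrightarrow> a *\<^sub>R x) (nhds a \<times>\<^sub>F nhds x)"
    by (simp add: nhds_prod)
next
  fix S :: "'a set" and x
  assume "open S" "x \<in> S"
  then obtain e where "e > 0" "ball x e \<subseteq> S"
    by (meson openE)
  then show "\<exists>V. open V \<and>
       (\<forall>v\<in>V. \<forall>w\<in>V. \<forall>s\<ge>0. \<forall>t\<ge>0. s + t = 1 \<longrightarrow> s *\<^sub>R v + t *\<^sub>R w \<in> V) \<and> x \<in> V \<and> V \<subseteq> S"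
    using convex_ball[of x e] unfolding convex_def by (intro exI[of _ "ball x e"]) simp
qed

lemma lcs_tendsto_add:
  fixes f g :: "'b \<Rightarrow> 'a::locally_convex_space"
  assumes "(f \<longlongrightarrow> x) F" and "(g \<longlongrightarrow> y) F"
  shows "((\<lambda>t. f t + g t) \<longlongrightarrow> x + y) F"
proof -
  have "LIM t F. (f t, g t) :> nhds x \<times>\<^sub>F nhds y"
    using assms by (rule filterlim_Pair)
  from filterlim_compose[OF tendsto_add_nhds_prod this] show ?thesis by simp
qed

lemma lcs_tendsto_scaleR:
  fixes g :: "'b \<Rightarrow> 'a::locally_convex_space"
  assumes "(f \<longlongrightarrow> a) F" and "(g \<longlongrightarrow> x) F"
  shows "((\<lambda>t. f t *\<^sub>R g t) \<longlongrightarrow> a *\<^sub>R x) F"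
proof -
  have "LIM t F. (f t, g t) :> nhds a \<times>\<^sub>F nhds x"
    using assms by (rule filterlim_Pair)
  from filterlim_compose[OF tendsto_scaleR_nhds_prod this] show ?thesis by simp
qed

instance prod :: (locally_convex_space, locally_convex_space) locally_convex_space
proof
  fix x y :: "'a \<times> 'b"
  show "((\<lambda>p. fst p + snd p) \<longlongrightarrow> x + y) (nhds x \<times>\<^sub>F nhds y)"
  proof -
    have 1: "((\<lambda>p. fst (fst p)) \<longlongrightarrow> fst x) (nhds (x, y))"
         "((\<lambda>p. fst (snd p)) \<longlongrightarrow> fst y) (nhds (x, y))"
         "((\<lambda>p. snd (fst p)) \<longlongrightarrow> snd x) (nhds (x, y))"
         "((\<lambda>p. snd (snd p)) \<longlongrightarrow> snd y) (nhds (x, y))"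
      using tendsto_fst[OF tendsto_fst[OF filterlim_ident[of "nhds (x, y)"]]]
        tendsto_fst[OF tendsto_snd[OF filterlim_ident[of "nhds (x, y)"]]]
        tendsto_snd[OF tendsto_fst[OF filterlim_ident[of "nhds (x, y)"]]]
        tendsto_snd[OF tendsto_snd[OF filterlim_ident[of "nhds (x, y)"]]] by simp_all
    have "((\<lambda>p. (fst (fst p) + fst (snd p), snd (fst p) + snd (snd p))) \<longlongrightarrow> (fst x + fst y, snd x + snd y))
        (nhds (x, y))"
      by (intro tendsto_Pair lcs_tendsto_add 1)
    then show ?thesis by (simp add: nhds_prod plus_prod_def)
  qed
next
  fix a :: real and x :: "'a \<times> 'b"
  have 1: "((\<lambda>p. fst p) \<longlongrightarrow> a) (nhds (a, x))"
       "((\<lambda>p. fst (snd p)) \<longlongrightarrow> fst x) (nhds (a, x))"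
       "((\<lambda>p. snd (snd p)) \<longlongrightarrow> snd x) (nhds (a, x))"
    using tendsto_fst[OF filterlim_ident[of "nhds (a, x)"]]
      tendsto_fst[OF tendsto_snd[OF filterlim_ident[of "nhds (a, x)"]]]
      tendsto_snd[OF tendsto_snd[OF filterlim_ident[of "nhds (a, x)"]]] by simp_all
  have "((\<lambda>p. (fst p *\<^sub>R fst (snd p), fst p *\<^sub>R snd (snd p))) \<longlongrightarrow> (a *\<^sub>R fst x, a *\<^sub>R snd x))
      (nhds (a, x))"
    by (intro tendsto_Pair lcs_tendsto_scaleR 1)
  then show "((\<lambda>p. fst p *\<^sub>R snd p) \<longlongrightarrow> a *\<^sub>R x) (nhds a \<times>\<^sub>F nhds x)"
    by (simp add: nhds_prod scaleR_prod_def)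
next
  fix S :: "('a \<times> 'b) set" and x
  assume "open S" "x \<in> S"
  then obtain A B where AB: "open A" "open B" "x \<in> A \<times> B" "A \<times> B \<subseteq> S"
    by (elim open_prod_elim)
  obtain V where V: "open V" "convex V" "fst x \<in> V" "V \<subseteq> A"
    using ex_open_convex_subset[OF AB(1), of "fst x"] AB(3) by (auto simp: mem_Times_iff)
  obtain W where W: "open W" "convex W" "snd x \<in> W" "W \<subseteq> B"
    using ex_open_convex_subset[OF AB(2), of "snd x"] AB(3) by (auto simp: mem_Times_iff)
  show "\<exists>V. open V \<and>
       (\<forall>v\<in>V. \<forall>w\<in>V. \<forall>s\<ge>0. \<forall>t\<ge>0. s + t = 1 \<longrightarrow> s *\<^sub>R v + t *\<^sub>R w \<in> V) \<and> x \<in> V \<and> V \<subseteq> S"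
    unfolding convex_def[symmetric] using V W AB(4) by (intro exI[of _ "V \<times> W"]) (auto intro!: open_Times convex_Times simp: mem_Times_iff)
qed


section \<open>Bastiani $C^r$-maps\<close>

definition dir_differentiable ::
    "('a::locally_convex_space \<Rightarrow> 'b::locally_convex_space) \<Rightarrow> 'a \<Rightarrow> 'a \<Rightarrow> bool" where
  "dir_differentiable f x y \<longleftrightarrow>
     (\<exists>l. ((\<lambda>t::real. (f (x + t *\<^sub>R y) - f x) /\<^sub>R t) \<longlongrightarrow> l) (at 0))"

definition dir_deriv ::
    "('a::locally_convex_space \<Rightarrow> 'b::locally_convex_space) \<Rightarrow> 'a \<Rightarrow> 'a \<Rightarrow> 'b" where
  "dir_deriv f x y = Lim (at 0) (\<lambda>t::real. (f (x + t *\<^sub>R y) - f x) /\<^sub>R t)"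

text \<open>\<^term>\<open>iter_dir_deriv k f x y\<close> is $(D_{y_k}\cdots D_{y_1} f)(x)$. The $k$-tuple of
  directions is a function on \<^term>\<open>{1..k::nat}\<close>, and $E^k$ is the product topology indexed by
  this set. At a point of an open set the values depend only on those of \<^term>\<open>f\<close> on that set.\<close>

primrec iter_dir_deriv ::
    "nat \<Rightarrow> ('a::locally_convex_space \<Rightarrow> 'b::locally_convex_space) \<Rightarrow> 'a \<Rightarrow> (nat \<Rightarrow> 'a) \<Rightarrow> 'b" where
  "iter_dir_deriv 0 f x y = f x"
| "iter_dir_deriv (Suc k) f x y = dir_deriv (\<lambda>x'. iter_dir_deriv k f x' y) x (y (Suc k))"

definition power_top :: "nat \<Rightarrow> (nat \<Rightarrow> 'a::topological_space) topology" where
  "power_top k = product_topology (\<lambda>_. euclidean) {1..k}"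

definition Cr_on_open ::
    "enat \<Rightarrow> 'a::locally_convex_space set \<Rightarrow> ('a \<Rightarrow> 'b::locally_convex_space) \<Rightarrow> bool" where
  "Cr_on_open r U f \<longleftrightarrow>
     open U \<and> continuous_on U f \<and>
     (\<forall>k. enat (Suc k) \<le> r \<longrightarrow>
        (\<forall>x\<in>U. \<forall>y\<in>topspace (power_top (Suc k)).
           dir_differentiable (\<lambda>x'. iter_dir_deriv k f x' y) x (y (Suc k)))) \<and>
     (\<forall>k. enat k \<le> r \<longrightarrow>
        continuous_map (prod_topology (top_of_set U) (power_top k)) euclidean
          (\<lambda>(x, y). iter_dir_deriv k f x y))"

definition Cr_domain :: "'a::locally_convex_space set \<Rightarrow> bool" where
  "Cr_domain U \<longleftrightarrow>
     U \<subseteq> closure (interior U) \<and>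
     (\<forall>x\<in>U. \<exists>V W. convex V \<and> V \<subseteq> U \<and> open W \<and> x \<in> W \<and> W \<inter> U \<subseteq> V)"

definition Cr_on ::
    "enat \<Rightarrow> 'a::locally_convex_space set \<Rightarrow> ('a \<Rightarrow> 'b::locally_convex_space) \<Rightarrow> bool" where
  "Cr_on r U f \<longleftrightarrow>
     Cr_domain U \<and> continuous_on U f \<and> Cr_on_open r (interior U) f \<and>
     (\<forall>k. enat k \<le> r \<longrightarrow>
        (\<exists>h. continuous_map (prod_topology (top_of_set U) (power_top k)) euclidean h \<and>
             (\<forall>x\<in>interior U. \<forall>y\<in>topspace (power_top k). h (x, y) = iter_dir_deriv k f x y)))"

text \<open>The codomain carries no smoothness structure of its own: a map into \<^term>\<open>B\<close> is $C^r$ iff it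
  is so as a map into the ambient space.\<close>

definition Cr_map ::
    "enat \<Rightarrow> 'a::locally_convex_space set \<Rightarrow> 'b::locally_convex_space set \<Rightarrow> ('a \<Rightarrow> 'b) \<Rightarrow> bool" where
  "Cr_map r A B f \<longleftrightarrow> f \<in> A \<rightarrow> B \<and> Cr_on r A f"

text \<open>Extensionality makes each bijection of \<^term>\<open>K\<close> occur exactly once as a total function.\<close>

definition Diff_fixing_frontier :: "enat \<Rightarrow> 'a::locally_convex_space set \<Rightarrow> ('a \<Rightarrow> 'a) set" where
  "Diff_fixing_frontier r K =
     {\<phi> \<in> extensional K. bij_betw \<phi> K K \<and> Cr_map r K K \<phi> \<and> Cr_map r K K (inv_into K \<phi>) \<and>
        (\<forall>x\<in>frontier K. \<phi> x = x)}"


section \<open>Consistency of the definitions\<close>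

lemma Cr_domain_open:
  assumes "open U"
  shows "Cr_domain U"
  unfolding Cr_domain_def
proof (intro conjI ballI)
  show "U \<subseteq> closure (interior U)"
    using assms by (simp add: interior_open closure_subset)
  fix x assume "x \<in> U"
  then obtain V where "open V" "convex V" "x \<in> V" "V \<subseteq> U"
    using ex_open_convex_subset[OF assms] by blast
  then show "\<exists>V W. convex V \<and> V \<subseteq> U \<and> open W \<and> x \<in> W \<and> W \<inter> U \<subseteq> V" by blast
qed

lemma Cr_on_iff_Cr_on_open:
  assumes "open U"
  shows "Cr_on r U f \<longleftrightarrow> Cr_on_open r U f"
proof
  show "Cr_on r U f" if "Cr_on_open r U f"
    using that assms Cr_domain_open[OF assms]
    by (fastforce simp: Cr_on_def interior_open Cr_on_open_def)
qed (use assms in \<open>simp add: Cr_on_def interior_open\<close>)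

lemma Cr_domain_convex:
  assumes "convex U" and "interior U \<noteq> {}"
  shows "Cr_domain U"
  unfolding Cr_domain_def
proof (intro conjI ballI)
  show "\<exists>V W. convex V \<and> V \<subseteq> U \<and> open W \<and> x \<in> W \<and> W \<inter> U \<subseteq> V" for x
    using assms(1) by (intro exI[of _ U] exI[of _ UNIV]) auto
  show "U \<subseteq> closure (interior U)"
  proof
    fix x assume "x \<in> U"
    obtain p where p: "p \<in> interior U" using assms(2) by blast
    define c where "c t = x + t *\<^sub>R (p - x)" for t :: real
    have in_interior: "c t \<in> interior U" if t: "0 < t" "t \<le> 1" for t
    proof -
      define q where "q z = p + inverse t *\<^sub>R (z + - c t)" for z
      have "continuous_on UNIV q"
        unfolding q_def continuous_on_def
        by (intro ballI lcs_tendsto_add lcs_tendsto_scaleR tendsto_const tendsto_ident_at)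
      then have op: "open (q -` interior U)"
        using open_vimage open_interior by blast
      have "q -` interior U \<subseteq> U"
      proof
        fix z assume "z \<in> q -` interior U"
        then have "q z \<in> U" using interior_subset by auto
        then have "(1 - t) *\<^sub>R x + t *\<^sub>R q z \<in> U"
          using \<open>x \<in> U\<close> assms(1) t by (intro convexD) auto
        moreover have "(1 - t) *\<^sub>R x + t *\<^sub>R q z = z"
          using t by (simp add: q_def c_def algebra_simps)
        ultimately show "z \<in> U" by simp
      qed
      moreover have "c t \<in> q -` interior U" using p by (simp add: q_def)
      ultimately show ?thesis using op by (meson interior_maximal subsetD)
    qed
    have lim: "(c \<longlongrightarrow> x + 0 *\<^sub>R (p - x)) (at_right 0)"
      unfolding c_def by (intro lcs_tendsto_add tendsto_const lcs_tendsto_scaleR tendsto_ident_at)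
    show "x \<in> closure (interior U)"
    proof (rule Lim_in_closed_set[OF closed_closure])
      show "\<forall>\<^sub>F t in at_right 0. c t \<in> closure (interior U)"
        using eventually_at_right_less[of "0::real"] eventually_at_right_real[of 0 1, simplified]
        by eventually_elim (use in_interior closure_subset in force)
      show "(c \<longlongrightarrow> x) (at_right 0)" using lim by simp
    qed simp
  qed
qed

lemma iter_dir_deriv_cong:
  assumes "open U" and "\<And>x. x \<in> U \<Longrightarrow> f x = g x"
  shows "x \<in> U \<Longrightarrow> iter_dir_deriv k f x y = iter_dir_deriv k g x y"
    and "x \<in> U \<Longrightarrow> dir_differentiable (\<lambda>x'. iter_dir_deriv k f x' y) x v
           \<longleftrightarrow> dir_differentiable (\<lambda>x'. iter_dir_deriv k g x' y) x v"
proof -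
  have near: "\<forall>\<^sub>F t in at (0::real). x + t *\<^sub>R v \<in> U" if "x \<in> U" for x v
  proof -
    have "((\<lambda>t. x + t *\<^sub>R v) \<longlongrightarrow> x + 0 *\<^sub>R v) (at (0::real))"
      by (intro lcs_tendsto_add tendsto_const lcs_tendsto_scaleR tendsto_ident_at)
    then show ?thesis using assms(1) that by (simp add: topological_tendstoD)
  qed
  have quot: "\<forall>\<^sub>F t in at (0::real). (F (x + t *\<^sub>R v) - F x) /\<^sub>R t = (G (x + t *\<^sub>R v) - G x) /\<^sub>R t"
    if "x \<in> U" "\<And>x. x \<in> U \<Longrightarrow> F x = G x" for F G :: "'a \<Rightarrow> 'b" and x v
    using near[OF that(1), of v] by eventually_elim (simp add: that)
  have *: "iter_dir_deriv k f x y = iter_dir_deriv k g x y" if "x \<in> U" for k x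
    using that
  proof (induction k arbitrary: x)
    case (Suc k)
    have "\<forall>\<^sub>F t in at (0::real).
        (iter_dir_deriv k f (x + t *\<^sub>R y (Suc k)) y - iter_dir_deriv k f x y) /\<^sub>R t =
        (iter_dir_deriv k g (x + t *\<^sub>R y (Suc k)) y - iter_dir_deriv k g x y) /\<^sub>R t"
      using Suc.prems Suc.IH by (rule quot)
    from tendsto_cong[OF this] show ?case
      by (simp add: dir_deriv_def Topological_Spaces.Lim_def)
  qed (simp add: assms(2))
  show "x \<in> U \<Longrightarrow> iter_dir_deriv k f x y = iter_dir_deriv k g x y" by (rule *)
  show "x \<in> U \<Longrightarrow> dir_differentiable (\<lambda>x'. iter_dir_deriv k f x' y) x v
           \<longleftrightarrow> dir_differentiable (\<lambda>x'. iter_dir_deriv k g x' y) x v"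
  proof -
    assume "x \<in> U"
    then have "\<forall>\<^sub>F t in at (0::real).
        (iter_dir_deriv k f (x + t *\<^sub>R v) y - iter_dir_deriv k f x y) /\<^sub>R t =
        (iter_dir_deriv k g (x + t *\<^sub>R v) y - iter_dir_deriv k g x y) /\<^sub>R t"
      using * by (rule quot)
    from tendsto_cong[OF this] show ?thesis
      by (simp add: dir_differentiable_def)
  qed
qed

lemma Cr_on_cong:
  assumes "\<And>x. x \<in> U \<Longrightarrow> f x = g x"
  shows "Cr_on r U f \<longleftrightarrow> Cr_on r U g"
proof -
  have eq: "f x = g x" if "x \<in> interior U" for x
    using assms that interior_subset by blast
  note cong = iter_dir_deriv_cong[OF open_interior eq, of U]
  have 1: "continuous_on V f \<longleftrightarrow> continuous_on V g" if "V \<subseteq> U" for V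
    using assms that by (intro continuous_on_cong) auto
  have 2: "continuous_map (prod_topology (top_of_set (interior U)) (power_top k)) euclidean
          (\<lambda>(x, y). iter_dir_deriv k f x y) \<longleftrightarrow>
        continuous_map (prod_topology (top_of_set (interior U)) (power_top k)) euclidean
          (\<lambda>(x, y). iter_dir_deriv k g x y)" for k
    by (intro iffI; rule continuous_map_eq, assumption) (auto simp: cong(1))
  have 3: "Cr_on_open r (interior U) f \<longleftrightarrow> Cr_on_open r (interior U) g"
    unfolding Cr_on_open_def using cong(2) 1[OF interior_subset] 2 by simp
  show ?thesis
    unfolding Cr_on_def using 1[OF order_refl] 3 cong(1) by simp
qed

end

theory Submission
  imports Defs
begin

text \<open>Write \<open>g (z, y)\<close> for the inverse. It is continuous since projections along the compact set
  \<open>K\<close> are closed, so no fixed point argument is needed: applying the mean value theorem to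
  each component of \<open>f (z, g (z, y)) = y\<close> and Cramer's rule yields its directional derivatives,
  as rational expressions in \<open>g\<close> and the first derivatives of \<open>f\<close> along \<open>(z, g (z, y))\<close>. The
  determinant in the denominator does not vanish, up to the boundary, because each fibre has a
  \<open>C\<^sup>1\<close> inverse on \<open>K\<close>. The same expressions extend the derivatives continuously to the boundary,
  and higher derivatives follow by induction in a class of functions closed under the operations
  involved.\<close>

section \<open>Mean value estimates for directional derivatives\<close>

text \<open>The obstacle is the boundary. Directional derivatives of \<open>f\<close> exist only
  over \<open>interior (U \<times> K)\<close>; elsewhere there are merely continuous extensions, and
  calculus does not apply to them directly. Three facts deal with this. Each fibre map fixes
  \<open>frontier K\<close>, hence permutes \<open>interior K\<close>, so
  \<open>(z, y) \<mapsto> (z, g (z, y))\<close> maps the interior of \<open>U \<times> K\<close>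
  into itself; on the interior, the formula for the derivative of \<open>g\<close> therefore
  involves genuine derivatives of \<open>f\<close> only. Identities between derivatives pass from
  the interior to the boundary by density. For \<open>z\<close> on the boundary of \<open>U\<close>,
  the fibre map is still differentiable over \<open>interior K\<close>, by mean value bounds that
  are uniform in nearby interior points \<open>z'\<close>. The induction gains one order per step
  because the formula for the first derivative of \<open>g\<close> contains \<open>g\<close> itself
  and first derivatives of \<open>f\<close>, but no derivative of \<open>g\<close>: if
  \<open>g\<close> is of order \<open>m\<close> and \<open>f\<close> of order \<open>m + 1\<close>,
  the right-hand side is of order \<open>m\<close>.\<close>

lemma tendsto_segment:
  fixes b c :: "'b \<Rightarrow> 'a::locally_convex_space"
  assumes b: "(b \<longlongrightarrow> a) F" and c: "(c \<longlongrightarrow> a) F"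
    and s: "\<forall>\<^sub>F t in F. 0 \<le> s t \<and> s t \<le> 1"
  shows "((\<lambda>t. b t + s t *\<^sub>R (c t - b t)) \<longlongrightarrow> a) F"
proof (rule topological_tendstoI)
  fix S assume "open S" "a \<in> S"
  \<comment> \<open>Local convexity does the work of a norm estimate: \<open>s t\<close> may
    oscillate, but a convex neighbourhood containing both endpoints contains the whole
    segment.\<close>
  then obtain V where V: "open V" "convex V" "a \<in> V" "V \<subseteq> S"
    using ex_open_convex_subset by blast
  have "\<forall>\<^sub>F t in F. b t \<in> V" "\<forall>\<^sub>F t in F. c t \<in> V"
    using b c V by (auto dest: topological_tendstoD)
  then show "\<forall>\<^sub>F t in F. b t + s t *\<^sub>R (c t - b t) \<in> S"
    using s
  proof eventually_elim
    case (elim t)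
    then have "(1 - s t) *\<^sub>R b t + s t *\<^sub>R c t \<in> V"
      using V(2) by (intro convexD) auto
    then show ?case using V(4) by (auto simp: algebra_simps)
  qed
qed

text \<open>\<open>h'\<close> is carried along instead of being computed by
  \<open>dir_deriv\<close>: in the applications it is a continuous extension that also has
  meaningful values off \<open>S\<close>.\<close>

definition has_dir_deriv_on ::
    "('a::locally_convex_space \<Rightarrow> real) \<Rightarrow> ('a \<Rightarrow> 'a \<Rightarrow> real) \<Rightarrow> 'a set \<Rightarrow> bool" where
  "has_dir_deriv_on h h' S \<longleftrightarrow>
     (\<forall>x\<in>S. \<forall>v. ((\<lambda>t. h (x + t *\<^sub>R v)) has_real_derivative h' x v) (at 0))"

lemma has_dir_deriv_onD:
  "has_dir_deriv_on h h' S \<Longrightarrow> x \<in> S \<Longrightarrow>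
     ((\<lambda>t. h (x + t *\<^sub>R v)) has_real_derivative h' x v) (at 0)"
  by (simp add: has_dir_deriv_on_def)

lemma has_dir_deriv_on_subset:
  "has_dir_deriv_on h h' S \<Longrightarrow> T \<subseteq> S \<Longrightarrow> has_dir_deriv_on h h' T"
  unfolding has_dir_deriv_on_def by blast

text \<open>Shifting the base point along the segment turns the derivative at time \<open>0\<close>
  into the derivative at time \<open>s\<close>, so the one-dimensional theorem applies.
  \<open>V\<close> may be thin: \<open>has_derivative_slice\<close> uses
  \<open>{z'} \<times> W\<close>.\<close>

lemma has_dir_deriv_on_mvt:
  assumes h: "has_dir_deriv_on h h' V" and V: "convex V" "b \<in> V" "c \<in> V"
  shows "\<exists>s. 0 \<le> s \<and> s \<le> 1 \<and> h c - h b = h' (b + s *\<^sub>R (c - b)) (c - b)"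
proof -
  have "((\<lambda>s. h (b + s *\<^sub>R (c - b))) has_real_derivative h' (b + s *\<^sub>R (c - b)) (c - b)) (at s)"
    if "0 \<le> s" "s \<le> 1" for s
  proof -
    have "(1 - s) *\<^sub>R b + s *\<^sub>R c \<in> V"
      using V that by (intro convexD) auto
    then have "b + s *\<^sub>R (c - b) \<in> V" by (simp add: algebra_simps)
    from has_dir_deriv_onD[OF h this, of "c - b"]
    have "((\<lambda>t. h (b + (t + s) *\<^sub>R (c - b))) has_real_derivative h' (b + s *\<^sub>R (c - b)) (c - b)) (at 0)"
      by (simp add: algebra_simps)
    then show ?thesis
      using DERIV_shift[of "\<lambda>s. h (b + s *\<^sub>R (c - b))" _ 0 s] by simp
  qed
  from MVT2[of 0 1 "\<lambda>s. h (b + s *\<^sub>R (c - b))", OF _ this]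
  obtain s where "0 < s" "s < 1" "h (b + 1 *\<^sub>R (c - b)) - h (b + 0 *\<^sub>R (c - b)) = (1 - 0) * h' (b + s *\<^sub>R (c - b)) (c - b)"
    by auto
  then show ?thesis by (intro exI[of _ s]) auto
qed

text \<open>The line is reparametrised by \<open>t * a\<close>; the case \<open>a = 0\<close> yields
  \<open>h' x 0 = 0\<close>.\<close>

lemma has_dir_deriv_on_scaleR:
  assumes h: "has_dir_deriv_on h h' S" and x: "x \<in> S"
  shows "h' x (a *\<^sub>R v) = a * h' x v"
proof -
  have "((\<lambda>t. h (x + (t * a) *\<^sub>R v)) has_real_derivative h' x v * a) (at 0)"
  proof (rule DERIV_chain2[where f = "\<lambda>t. h (x + t *\<^sub>R v)" and g = "\<lambda>t. t * a"])
    show "((\<lambda>t. h (x + t *\<^sub>R v)) has_real_derivative h' x v) (at (0 * a))"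
      using has_dir_deriv_onD[OF h x] by simp
    show "((\<lambda>t. t * a) has_real_derivative a) (at 0)"
      by (auto intro!: derivative_eq_intros)
  qed
  moreover have "((\<lambda>t. h (x + (t * a) *\<^sub>R v)) has_real_derivative h' x (a *\<^sub>R v)) (at 0)"
    using has_dir_deriv_onD[OF h x, of "a *\<^sub>R v"] by simp
  ultimately show ?thesis
    using DERIV_unique by fastforce
qed

text \<open>The mean value theorem writes the increment as \<open>h'\<close> at a point tending to
  \<open>a\<close>, homogeneity moves the factor \<open>1 / t\<close> into the direction, and joint
  continuity of \<open>h'\<close> gives the limit. Letting both endpoints move is what yields
  additivity of \<open>h' a\<close>; a constant \<open>b\<close> gives the chain rule.\<close>

lemma has_dir_deriv_on_strict:
  fixes b c :: "real \<Rightarrow> 'a::locally_convex_space"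
  assumes h: "has_dir_deriv_on h h' S" and S: "open S" "a \<in> S"
    and h': "continuous_on (S \<times> UNIV) (\<lambda>(x, v). h' x v)"
    and b: "(b \<longlongrightarrow> a) (at 0)" and c: "(c \<longlongrightarrow> a) (at 0)"
    and u: "((\<lambda>t. (c t - b t) /\<^sub>R t) \<longlongrightarrow> u) (at 0)"
  shows "((\<lambda>t. (h (c t) - h (b t)) / t) \<longlongrightarrow> h' a u) (at 0)"
proof -
  obtain V where V: "open V" "convex V" "a \<in> V" "V \<subseteq> S"
    using ex_open_convex_subset S by blast
  have hV: "has_dir_deriv_on h h' V"
    using h V(4) by (rule has_dir_deriv_on_subset)
  define P where "P t s \<longleftrightarrow> 0 \<le> s \<and> s \<le> 1 \<and> h (c t) - h (b t) = h' (b t + s *\<^sub>R (c t - b t)) (c t - b t)"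
    for t s
  \<comment> \<open>The choice is meaningful only for \<open>t\<close> close to \<open>0\<close>,
    where both endpoints lie in \<open>V\<close>.\<close>
  define s where "s t = (SOME s. P t s)" for t
  have ev: "\<forall>\<^sub>F t in at 0. b t \<in> V" "\<forall>\<^sub>F t in at 0. c t \<in> V"
    using b c V by (auto dest: topological_tendstoD)
  have P: "\<forall>\<^sub>F t in at 0. P t (s t)"
    using ev
  proof eventually_elim
    case (elim t)
    then have "\<exists>s. P t s" unfolding P_def using has_dir_deriv_on_mvt[OF hV V(2)] by blast
    then show ?case unfolding s_def by (rule someI_ex)
  qed
  define \<xi> where "\<xi> t = b t + s t *\<^sub>R (c t - b t)" for t
  have \<xi>: "(\<xi> \<longlongrightarrow> a) (at 0)"
    unfolding \<xi>_def using P by (intro tendsto_segment b c) (auto simp: P_def elim: eventually_mono)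
  have lim: "((\<lambda>t. (\<lambda>(x, v). h' x v) (\<xi> t, (c t - b t) /\<^sub>R t)) \<longlongrightarrow> (\<lambda>(x, v). h' x v) (a, u)) (at 0)"
  proof (rule continuous_on_tendsto_compose[OF h'])
    show "((\<lambda>t. (\<xi> t, (c t - b t) /\<^sub>R t)) \<longlongrightarrow> (a, u)) (at 0)"
      by (intro tendsto_Pair \<xi> u)
    show "\<forall>\<^sub>F t in at 0. (\<xi> t, (c t - b t) /\<^sub>R t) \<in> S \<times> UNIV"
      using topological_tendstoD[OF \<xi> S] by eventually_elim auto
  qed (use S in auto)
  have "\<forall>\<^sub>F t in at 0. h' (\<xi> t) ((c t - b t) /\<^sub>R t) = (h (c t) - h (b t)) / t"
    using P topological_tendstoD[OF \<xi> S]
  proof eventually_elim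
    case (elim t)
    then show ?case
      using has_dir_deriv_on_scaleR[OF h elim(2)] by (simp add: P_def \<xi>_def divide_inverse_commute)
  qed
  then show ?thesis using lim by (auto intro: Lim_transform_eventually)
qed

lemma tendsto_line:
  fixes x v :: "'a::locally_convex_space"
  shows "((\<lambda>t::real. x + t *\<^sub>R v) \<longlongrightarrow> x) (at 0 within S)"
proof -
  have "((\<lambda>t::real. x + t *\<^sub>R v) \<longlongrightarrow> x + 0 *\<^sub>R v) (at 0 within S)"
    by (intro lcs_tendsto_add lcs_tendsto_scaleR tendsto_const tendsto_ident_at)
  then show ?thesis by simp
qed

text \<open>For additivity the increment is split at \<open>a + t *\<^sub>R u\<close>. The second
  leg starts at a moving point, but its increment divided by \<open>t\<close> is exactly
  \<open>v\<close>, so the strict estimate applies.\<close>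

lemma has_dir_deriv_on_linear:
  assumes h: "has_dir_deriv_on h h' S" and S: "open S" "a \<in> S"
    and h': "continuous_on (S \<times> UNIV) (\<lambda>(x, v). h' x v)"
  shows "linear (h' a)"
proof
  show "h' a (r *\<^sub>R v) = r *\<^sub>R h' a v" for r v
    using has_dir_deriv_on_scaleR[OF h S(2)] by simp
  fix u v
  have *: "((\<lambda>t. (h (a + t *\<^sub>R w) - h a) / t) \<longlongrightarrow> h' a w) (at 0)" for w
    using has_dir_deriv_onD[OF h S(2), of w] by (simp add: has_field_derivative_iff)
  have "((\<lambda>t::real. ((a + t *\<^sub>R (u + v)) - (a + t *\<^sub>R u)) /\<^sub>R t) \<longlongrightarrow> v) (at 0)"
    by (rule tendsto_eventually) (auto simp: eventually_at_filter algebra_simps)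
  from has_dir_deriv_on_strict[OF h S h' tendsto_line tendsto_line this]
  have "((\<lambda>t. (h (a + t *\<^sub>R (u + v)) - h (a + t *\<^sub>R u)) / t + (h (a + t *\<^sub>R u) - h a) / t)
      \<longlongrightarrow> h' a v + h' a u) (at 0)"
    by (intro tendsto_add *)
  then have "((\<lambda>t. (h (a + t *\<^sub>R (u + v)) - h a) / t) \<longlongrightarrow> h' a v + h' a u) (at 0)"
    by (simp add: diff_divide_distrib)
  from tendsto_unique[OF _ * this] show "h' a (u + v) = h' a u + h' a v" by simp
qed

text \<open>A chain rule along a single line: the inner map enters only through its limit and its
  difference quotient in the direction \<open>v\<close>.\<close>

lemma has_dir_deriv_on_compose:
  fixes \<Phi> :: "'b::locally_convex_space \<Rightarrow> 'a::locally_convex_space"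
  assumes h: "has_dir_deriv_on h h' S" and S: "open S" "\<Phi> x \<in> S"
    and h': "continuous_on (S \<times> UNIV) (\<lambda>(x, v). h' x v)"
    and \<Phi>: "((\<lambda>t. \<Phi> (x + t *\<^sub>R v)) \<longlongrightarrow> \<Phi> x) (at 0)"
    and u: "((\<lambda>t. (\<Phi> (x + t *\<^sub>R v) - \<Phi> x) /\<^sub>R t) \<longlongrightarrow> u) (at 0)"
  shows "((\<lambda>t. h (\<Phi> (x + t *\<^sub>R v))) has_real_derivative h' (\<Phi> x) u) (at 0)"
  using has_dir_deriv_on_strict[OF h S h' tendsto_const \<Phi> u]
  by (simp add: has_field_derivative_iff)


section \<open>Functions of class $C^k$ depending on parameters\<close>

text \<open>Curried, so that freezing a parameter, substituting for it or adding a new one as in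
  \<open>\<lambda>x (v, p). H' x v p\<close> leaves the domain \<open>X\<close> untouched.\<close>

definition jointly_continuous ::
    "'a::topological_space set \<Rightarrow> ('a \<Rightarrow> 'p::topological_space \<Rightarrow> 'b::topological_space) \<Rightarrow> bool" where
  "jointly_continuous X H \<longleftrightarrow> continuous_on (X \<times> UNIV) (\<lambda>(x, p). H x p)"

lemma jointly_continuous_param:
  assumes "jointly_continuous X H" and "continuous_on UNIV \<delta>"
  shows "jointly_continuous X (\<lambda>x p. H x (\<delta> p))"
  unfolding jointly_continuous_def case_prod_unfold
proof (rule continuous_on_compose2[OF assms(1)[unfolded jointly_continuous_def case_prod_unfold],
    where f = "\<lambda>q. (fst q, \<delta> (snd q))", simplified])
  show "continuous_on (X \<times> UNIV) (\<lambda>q. (fst q, \<delta> (snd q)))"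
    by (intro continuous_on_Pair continuous_on_fst continuous_on_id
        continuous_on_compose2[OF assms(2)] continuous_on_snd) auto
qed auto

lemma jointly_continuous_base:
  assumes "jointly_continuous X H" and "continuous_on Y \<Phi>" and "\<Phi> \<in> Y \<rightarrow> X"
  shows "jointly_continuous Y (\<lambda>x p. H (\<Phi> x) p)"
  unfolding jointly_continuous_def case_prod_unfold
proof (rule continuous_on_compose2[OF assms(1)[unfolded jointly_continuous_def case_prod_unfold],
    where f = "\<lambda>q. (\<Phi> (fst q), snd q)", simplified])
  show "continuous_on (Y \<times> UNIV) (\<lambda>q. (\<Phi> (fst q), snd q))"
    by (intro continuous_on_Pair continuous_on_snd continuous_on_id
        continuous_on_compose2[OF assms(2)] continuous_on_fst) auto
  show "(\<lambda>q. (\<Phi> (fst q), snd q)) ` (Y \<times> UNIV) \<subseteq> X \<times> UNIV"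
    using assms(3) by auto
qed

lemma jointly_continuous_slice:
  assumes "jointly_continuous X H"
  shows "continuous_on X (\<lambda>x. H x p)"
  using continuous_on_compose2[OF assms[unfolded jointly_continuous_def], of X "\<lambda>x. (x, p)"]
  by (force intro: continuous_on_Pair continuous_on_id continuous_on_const)

lemma jointly_continuous_snd_param:
  assumes "jointly_continuous X H"
  shows "jointly_continuous X (\<lambda>x (v, p). H x p)"
  using jointly_continuous_param[OF assms continuous_on_snd[OF continuous_on_id]]
  by (simp add: case_prod_unfold)

lemma jointly_continuous_subset:
  "jointly_continuous X H \<Longrightarrow> Y \<subseteq> X \<Longrightarrow> jointly_continuous Y H"
  unfolding jointly_continuous_def by (rule continuous_on_subset) auto

text \<open>The parameters \<^term>\<open>p\<close> carry the directions of the derivatives already taken, so that a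
  derivative in a direction depending on the parameters stays in the class. All functions are
  real-valued, hence the usual one-dimensional calculus applies along lines.\<close>

primrec param_Ck ::
    "nat \<Rightarrow> 'a::locally_convex_space set \<Rightarrow> ('a \<Rightarrow> 'p::topological_space \<Rightarrow> real) \<Rightarrow> bool" where
  "param_Ck 0 X H \<longleftrightarrow> jointly_continuous X H"
| "param_Ck (Suc k) X H \<longleftrightarrow> jointly_continuous X H \<and>
     (\<exists>H'. jointly_continuous X (\<lambda>x (v, p). H' x v p) \<and>
        (\<forall>p. has_dir_deriv_on (\<lambda>x. H x p) (\<lambda>x v. H' x v p) (interior X)) \<and>
        (\<forall>\<delta>. continuous_on UNIV \<delta> \<longrightarrow> param_Ck k X (\<lambda>x p. H' x (\<delta> p) p)))"

section \<open>Closure properties of the class\<close>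

lemma param_CkI:
  assumes "jointly_continuous X H" and "jointly_continuous X (\<lambda>x (v, p). H' x v p)"
    and "\<And>p. has_dir_deriv_on (\<lambda>x. H x p) (\<lambda>x v. H' x v p) (interior X)"
    and "\<And>\<delta>. continuous_on UNIV \<delta> \<Longrightarrow> param_Ck k X (\<lambda>x p. H' x (\<delta> p) p)"
  shows "param_Ck (Suc k) X H"
  using assms by auto

lemma param_Ck_cont: "param_Ck k X H \<Longrightarrow> jointly_continuous X H"
  by (cases k) auto

lemma param_Ck_Suc_imp: "param_Ck (Suc k) X H \<Longrightarrow> param_Ck k X H"
proof (induction k arbitrary: H)
  case (Suc k)
  then obtain H' where "jointly_continuous X H" "jointly_continuous X (\<lambda>x (v, p). H' x v p)"
      "\<And>p. has_dir_deriv_on (\<lambda>x. H x p) (\<lambda>x v. H' x v p) (interior X)"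
      "\<And>\<delta>. continuous_on UNIV \<delta> \<Longrightarrow> param_Ck (Suc k) X (\<lambda>x p. H' x (\<delta> p) p)"
    by auto
  then show ?case by (intro param_CkI[of X H H'] Suc.IH)
qed simp

text \<open>This brings in constants and the coordinates of a direction that depends on the
  parameter; their derivative in \<open>x\<close> is \<open>0\<close>.\<close>

lemma param_Ck_of_param:
  fixes q :: "'p::topological_space \<Rightarrow> real"
  assumes "continuous_on UNIV q"
  shows "param_Ck k X (\<lambda>x p. q p)"
  using assms
proof (induction k arbitrary: q)
  case 0
  then show ?case
    by (auto simp: jointly_continuous_def case_prod_unfold intro!: continuous_on_compose2[OF 0] continuous_on_snd continuous_on_id)
next
  case (Suc k)
  have 0: "jointly_continuous X (\<lambda>x p. q p)"
    using Suc.prems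
    by (auto simp: jointly_continuous_def case_prod_unfold
        intro!: continuous_on_compose2[OF Suc.prems] continuous_on_snd continuous_on_id)
  show ?case
    by (rule param_CkI[where H' = "\<lambda>_ _ _. 0"])
      (use 0 Suc.IH[of "\<lambda>_. 0"] in \<open>auto simp: has_dir_deriv_on_def jointly_continuous_def case_prod_unfold\<close>)
qed

lemma param_Ck_add:
  assumes "param_Ck k X G" and "param_Ck k X H"
  shows "param_Ck k X (\<lambda>x p. G x p + H x p)"
  using assms
proof (induction k arbitrary: G H)
  case 0
  then show ?case by (auto simp: jointly_continuous_def case_prod_unfold intro!: continuous_on_add)
next
  case (Suc k)
  from Suc.prems obtain G' H'
    where G: "jointly_continuous X G" "jointly_continuous X (\<lambda>x (v, p). G' x v p)"
      "\<And>p. has_dir_deriv_on (\<lambda>x. G x p) (\<lambda>x v. G' x v p) (interior X)"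
      "\<And>\<delta>. continuous_on UNIV \<delta> \<Longrightarrow> param_Ck k X (\<lambda>x p. G' x (\<delta> p) p)"
    and H: "jointly_continuous X H" "jointly_continuous X (\<lambda>x (v, p). H' x v p)"
      "\<And>p. has_dir_deriv_on (\<lambda>x. H x p) (\<lambda>x v. H' x v p) (interior X)"
      "\<And>\<delta>. continuous_on UNIV \<delta> \<Longrightarrow> param_Ck k X (\<lambda>x p. H' x (\<delta> p) p)"
    by (auto simp only: param_Ck.simps)
  show ?case
  proof (rule param_CkI[where H' = "\<lambda>x v p. G' x v p + H' x v p"])
    show "has_dir_deriv_on (\<lambda>x. G x p + H x p) (\<lambda>x v. G' x v p + H' x v p) (interior X)" for p
      using G(3) H(3) by (auto simp: has_dir_deriv_on_def intro!: derivative_eq_intros)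
    show "param_Ck k X (\<lambda>x p. G' x (\<delta> p) p + H' x (\<delta> p) p)" if "continuous_on UNIV \<delta>" for \<delta>
      using that by (intro Suc.IH G H)
  qed (use G H in \<open>auto simp: jointly_continuous_def case_prod_unfold intro!: continuous_on_add\<close>)
qed

lemma param_Ck_mult:
  assumes "param_Ck k X G" and "param_Ck k X H"
  shows "param_Ck k X (\<lambda>x p. G x p * H x p)"
  using assms
proof (induction k arbitrary: G H)
  case 0
  then show ?case by (auto simp: jointly_continuous_def case_prod_unfold intro!: continuous_on_mult)
next
  case (Suc k)
  from Suc.prems obtain G' H'
    where G: "jointly_continuous X G" "jointly_continuous X (\<lambda>x (v, p). G' x v p)"
      "\<And>p. has_dir_deriv_on (\<lambda>x. G x p) (\<lambda>x v. G' x v p) (interior X)"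
      "\<And>\<delta>. continuous_on UNIV \<delta> \<Longrightarrow> param_Ck k X (\<lambda>x p. G' x (\<delta> p) p)"
    and H: "jointly_continuous X H" "jointly_continuous X (\<lambda>x (v, p). H' x v p)"
      "\<And>p. has_dir_deriv_on (\<lambda>x. H x p) (\<lambda>x v. H' x v p) (interior X)"
      "\<And>\<delta>. continuous_on UNIV \<delta> \<Longrightarrow> param_Ck k X (\<lambda>x p. H' x (\<delta> p) p)"
    by (auto simp only: param_Ck.simps)
  have GH: "jointly_continuous X (\<lambda>x (v, p). G x p)" "jointly_continuous X (\<lambda>x (v, p). H x p)"
    using G(1) H(1) by (simp_all only: jointly_continuous_snd_param)
  show ?case
  proof (rule param_CkI[where H' = "\<lambda>x v p. G' x v p * H x p + H' x v p * G x p"])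
    show "has_dir_deriv_on (\<lambda>x. G x p * H x p) (\<lambda>x v. G' x v p * H x p + H' x v p * G x p) (interior X)" for p
      using G(3) H(3) by (auto simp: has_dir_deriv_on_def intro!: derivative_eq_intros)
    show "param_Ck k X (\<lambda>x p. G' x (\<delta> p) p * H x p + H' x (\<delta> p) p * G x p)" if "continuous_on UNIV \<delta>" for \<delta>
      by (intro param_Ck_add Suc.IH G(4) H(4) that Suc.prems[THEN param_Ck_Suc_imp])
  qed (use G H GH in \<open>auto simp: jointly_continuous_def case_prod_unfold intro!: continuous_on_add continuous_on_mult\<close>)
qed

text \<open>The derivative of a reciprocal is a product of \<open>H'\<close> and two copies of that
  reciprocal, which the induction hypothesis covers one order lower. The sign is written as the
  constant \<open>-1\<close>, so that closure under products suffices.\<close>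

lemma param_Ck_inverse:
  assumes "param_Ck k X H" and "\<And>x p. x \<in> X \<Longrightarrow> H x p \<noteq> 0"
  shows "param_Ck k X (\<lambda>x p. inverse (H x p))"
  using assms
proof (induction k arbitrary: H)
  case 0
  then show ?case by (auto simp: jointly_continuous_def case_prod_unfold intro!: continuous_on_inverse)
next
  case (Suc k)
  from Suc.prems obtain H'
    where H: "jointly_continuous X H" "jointly_continuous X (\<lambda>x (v, p). H' x v p)"
      "\<And>p. has_dir_deriv_on (\<lambda>x. H x p) (\<lambda>x v. H' x v p) (interior X)"
      "\<And>\<delta>. continuous_on UNIV \<delta> \<Longrightarrow> param_Ck k X (\<lambda>x p. H' x (\<delta> p) p)"
    by (auto simp only: param_Ck.simps)
  have GH: "jointly_continuous X (\<lambda>x (v, p). H x p)"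
    using H(1) by (rule jointly_continuous_snd_param)
  show ?case
  proof (rule param_CkI[where H' = "\<lambda>x v p. (-1) * (H' x v p * (inverse (H x p) * inverse (H x p)))"])
    show "has_dir_deriv_on (\<lambda>x. inverse (H x p))
        (\<lambda>x v. (-1) * (H' x v p * (inverse (H x p) * inverse (H x p)))) (interior X)" for p
      unfolding has_dir_deriv_on_def
    proof (intro ballI allI)
      fix x v assume x: "x \<in> interior X"
      then have "H x p \<noteq> 0" using Suc.prems interior_subset by blast
      then show "((\<lambda>t. inverse (H (x + t *\<^sub>R v) p)) has_real_derivative
          (-1) * (H' x v p * (inverse (H x p) * inverse (H x p)))) (at 0)"
        using DERIV_inverse_fun[OF has_dir_deriv_onD[OF H(3) x]]
        by (simp add: mult.commute mult.left_commute)
    qed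
    show "param_Ck k X (\<lambda>x p. (-1) * (H' x (\<delta> p) p * (inverse (H x p) * inverse (H x p))))"
      if "continuous_on UNIV \<delta>" for \<delta>
    proof -
      have "param_Ck k X (\<lambda>x p. inverse (H x p))"
        by (rule Suc.IH[OF param_Ck_Suc_imp[OF Suc.prems(1)] Suc.prems(2)])
      moreover have "param_Ck k X (\<lambda>x p. -1)"
        by (rule param_Ck_of_param) (rule continuous_on_const)
      ultimately show ?thesis
        by (intro param_Ck_mult H(4) that)
    qed
    show "jointly_continuous X
        (\<lambda>x (v, p). (-1) * (H' x v p * (inverse (H x p) * inverse (H x p))))"
      using H(2) GH Suc.prems(2) unfolding jointly_continuous_def case_prod_unfold
      by (intro continuous_on_mult continuous_on_inverse continuous_on_const) auto
    show "jointly_continuous X (\<lambda>x p. inverse (H x p))"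
      using H(1) Suc.prems(2) unfolding jointly_continuous_def case_prod_unfold
      by (intro continuous_on_inverse) auto
  qed
qed

lemma param_Ck_sum:
  assumes "\<And>i. i \<in> I \<Longrightarrow> param_Ck k X (H i)"
  shows "param_Ck k X (\<lambda>x p. \<Sum>i\<in>I. H i x p)"
  using assms
proof (induction I rule: infinite_finite_induct)
  case (insert i I)
  then show ?case by (simp add: param_Ck_add)
qed (simp_all add: param_Ck_of_param)

lemma param_Ck_prod:
  assumes "\<And>i. i \<in> I \<Longrightarrow> param_Ck k X (H i)"
  shows "param_Ck k X (\<lambda>x p. \<Prod>i\<in>I. H i x p)"
  using assms
proof (induction I rule: infinite_finite_induct)
  case (insert i I)
  then show ?case by (simp add: param_Ck_mult)
qed (simp_all add: param_Ck_of_param)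

lemma param_Ck_det:
  fixes M :: "'a::locally_convex_space \<Rightarrow> 'p::topological_space \<Rightarrow> 'n::finite \<Rightarrow> 'n \<Rightarrow> real"
  assumes "\<And>i j. param_Ck k X (\<lambda>x p. M x p i j)"
  shows "param_Ck k X (\<lambda>x p. det (\<chi> i j. M x p i j))"
  unfolding det_def vec_lambda_beta
proof (rule param_Ck_sum, rule param_Ck_mult)
  show "param_Ck k X (\<lambda>x p. of_int (sign \<pi>))" for \<pi> :: "'n \<Rightarrow> 'n"
    by (rule param_Ck_of_param) (rule continuous_on_const)
  show "param_Ck k X (\<lambda>x p. \<Prod>i\<in>UNIV. M x p i (\<pi> i))" for \<pi>
    by (rule param_Ck_prod) (rule assms)
qed

text \<open>With coefficients \<open>c\<close> that vary with the base point, the directions on the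
  right still do not. Read with \<open>c\<close> as the unknown, the identity is one row of the
  linear system solved in \<open>implicit_dir_deriv\<close>.\<close>

lemma linear_prod_vec_expand:
  fixes h :: "'f::real_vector \<times> (real ^ 'n) \<Rightarrow> real"
  assumes "linear h"
  shows "h (w, c) = h (w, 0) + (\<Sum>j\<in>UNIV. c $ j * h (0, axis j 1))"
proof -
  have "(w, c) = (w, 0) + (\<Sum>j\<in>UNIV. c $ j *\<^sub>R (0, axis j 1))"
    by (simp add: prod_eq_iff fst_sum snd_sum basis_expansion flip: scalar_mult_eq_scaleR)
  then have "h (w, c) = h ((w, 0) + (\<Sum>j\<in>UNIV. c $ j *\<^sub>R (0, axis j 1)))" by simp
  then show ?thesis
    by (simp only: linear_add[OF assms] linear_sum[OF assms] linear_cmul[OF assms] real_scaleR_def)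
qed

text \<open>Only the finite-dimensional component is replaced, so the derivative splits into the direction
  \<open>(w, 0)\<close>, which does not depend on the base point, and finitely many constant directions, with
  coefficients that again belong to the class.\<close>

lemma param_Ck_compose_snd:
  fixes X :: "('f::locally_convex_space \<times> (real ^ 'n)) set"
    and g :: "'f \<times> (real ^ 'n) \<Rightarrow> real ^ 'n"
    and H :: "'f \<times> (real ^ 'n) \<Rightarrow> 'p::topological_space \<Rightarrow> real"
  defines "\<Phi> \<equiv> \<lambda>x. (fst x, g x)"
  assumes H: "param_Ck k X H" and g: "\<And>i. param_Ck k X (\<lambda>x (p::'p). g x $ i)"
    and \<Phi>: "\<Phi> \<in> X \<rightarrow> X" "\<Phi> \<in> interior X \<rightarrow> interior X"
  shows "param_Ck k X (\<lambda>x p. H (\<Phi> x) p)"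
proof -
  have "continuous_on X g"
  proof -
    have "continuous_on X (\<lambda>x. \<chi> i. g x $ i)"
      using jointly_continuous_slice[OF param_Ck_cont[OF g]] by (intro continuous_on_vec_lambda)
    then show ?thesis by simp
  qed
  then have cont: "continuous_on X \<Phi>"
    unfolding \<Phi>_def by (intro continuous_on_Pair continuous_on_fst continuous_on_id)
  show ?thesis using H g
  proof (induction k arbitrary: H)
    case 0
    then show ?case using jointly_continuous_base[OF _ cont \<Phi>(1)] by simp
  next
    case (Suc k)
    obtain H'
      where H: "jointly_continuous X H" "jointly_continuous X (\<lambda>x (v, p). H' x v p)"
        "\<And>p. has_dir_deriv_on (\<lambda>x. H x p) (\<lambda>x v. H' x v p) (interior X)"
        "\<And>\<delta>. continuous_on UNIV \<delta> \<Longrightarrow> param_Ck k X (\<lambda>x p. H' x (\<delta> p) p)"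
      using Suc.prems(1) by (auto simp only: param_Ck.simps)
    have "\<forall>i. \<exists>G'. jointly_continuous X (\<lambda>x (v, p::'p). G' x v p) \<and>
        (\<forall>p. has_dir_deriv_on (\<lambda>x. g x $ i) (\<lambda>x v. G' x v p) (interior X)) \<and>
        (\<forall>\<delta>. continuous_on UNIV \<delta> \<longrightarrow> param_Ck k X (\<lambda>x p. G' x (\<delta> p) p))"
      using Suc.prems(2) by (auto simp only: param_Ck.simps)
    from choice[OF this] obtain G' where G:
        "\<And>i. jointly_continuous X (\<lambda>x (v, p::'p). G' i x v p)"
        "\<And>i p. has_dir_deriv_on (\<lambda>x. g x $ i) (\<lambda>x v. G' i x v p) (interior X)"
        "\<And>i \<delta>. continuous_on UNIV \<delta> \<Longrightarrow> param_Ck k X (\<lambda>x p. G' i x (\<delta> p) p)"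
      by blast
    have H\<Phi>: "jointly_continuous X (\<lambda>x (v, p). H' (\<Phi> x) (d v) p)" if "continuous_on UNIV d" for d
    proof -
      have "continuous_on UNIV (\<lambda>q. (d (fst q), snd q) :: _ \<times> 'p)"
        by (intro continuous_on_Pair continuous_on_compose2[OF that] continuous_on_fst
            continuous_on_snd continuous_on_id) auto
      from jointly_continuous_base[OF jointly_continuous_param[OF H(2) this] cont \<Phi>(1)]
      show ?thesis by (simp add: case_prod_unfold)
    qed
    have inj0: "continuous_on UNIV (\<lambda>v. (fst v, 0))"
      by (intro continuous_on_Pair continuous_on_fst continuous_on_id continuous_on_const)
    show ?case
    proof (rule param_CkI[where H' =
          "\<lambda>x v p. H' (\<Phi> x) (fst v, 0) p + (\<Sum>j\<in>UNIV. G' j x v p * H' (\<Phi> x) (0, axis j 1) p)"])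
      show "jointly_continuous X (\<lambda>x p. H (\<Phi> x) p)"
        using jointly_continuous_base[OF H(1) cont \<Phi>(1)] .
      show "jointly_continuous X (\<lambda>x (v, p). H' (\<Phi> x) (fst v, 0) p +
          (\<Sum>j\<in>UNIV. G' j x v p * H' (\<Phi> x) (0, axis j 1) p))"
        using H\<Phi>[OF inj0] H\<Phi>[OF continuous_on_const] G(1)
        unfolding jointly_continuous_def case_prod_unfold
        by (intro continuous_on_add continuous_on_sum continuous_on_mult)
      show "param_Ck k X (\<lambda>x p. H' (\<Phi> x) (fst (\<delta> p), 0) p +
          (\<Sum>j\<in>UNIV. G' j x (\<delta> p) p * H' (\<Phi> x) (0, axis j 1) p))"
        if \<delta>: "continuous_on UNIV \<delta>" for \<delta>
      proof (intro param_Ck_add param_Ck_sum param_Ck_mult G(3) \<delta>)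
        have *: "param_Ck k X (\<lambda>x (p::'p). g x $ i)" for i
          using Suc.prems(2) by (rule param_Ck_Suc_imp)
        show "param_Ck k X (\<lambda>x p. H' (\<Phi> x) (fst (\<delta> p), 0) p)"
          using \<delta> by (intro Suc.IH * H(4) continuous_on_Pair continuous_on_fst continuous_on_const)
        show "param_Ck k X (\<lambda>x p. H' (\<Phi> x) (0, axis j 1) p)" for j
          by (intro Suc.IH * H(4) continuous_on_const)
      qed
      show "has_dir_deriv_on (\<lambda>x. H (\<Phi> x) p) (\<lambda>x v. H' (\<Phi> x) (fst v, 0) p +
          (\<Sum>j\<in>UNIV. G' j x v p * H' (\<Phi> x) (0, axis j 1) p)) (interior X)" for p
        unfolding has_dir_deriv_on_def
      proof (intro ballI allI)
        fix x v assume x: "x \<in> interior X"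
        \<comment> \<open>Linearity of \<open>H'\<close> in the direction and the chain rule are
          available over the interior, hence the requirement that \<open>\<Phi>\<close> preserve
          it.\<close>
        then have \<Phi>x: "\<Phi> x \<in> interior X" using \<Phi>(2) by auto
        have H'p: "continuous_on (interior X \<times> UNIV) (\<lambda>(x, v). H' x v p)"
        proof -
          have "continuous_on UNIV (\<lambda>v :: 'f \<times> (real ^ 'n). (v, p))"
            by (intro continuous_on_Pair continuous_on_const continuous_on_id)
          from jointly_continuous_subset[OF jointly_continuous_param[OF H(2) this] interior_subset]
          show ?thesis by (simp add: jointly_continuous_def)
        qed
        note lin = has_dir_deriv_on_linear[OF H(3) open_interior \<Phi>x H'p]
        have "((\<lambda>t. (g (x + t *\<^sub>R v) $ i - g x $ i) / t) \<longlongrightarrow> G' i x v p) (at 0)" for i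
          using has_dir_deriv_onD[OF G(2) x] by (simp add: has_field_derivative_iff)
        then have "((\<lambda>t. (g (x + t *\<^sub>R v) - g x) /\<^sub>R t) \<longlongrightarrow> (\<chi> i. G' i x v p)) (at 0)"
          by (intro vec_tendstoI) (simp add: divide_inverse_commute)
        moreover have "((\<lambda>t. ((fst x + t *\<^sub>R fst v) - fst x) /\<^sub>R t) \<longlongrightarrow> fst v) (at (0::real))"
          by (rule tendsto_eventually) (auto simp: eventually_at_filter)
        ultimately have "((\<lambda>t. (\<Phi> (x + t *\<^sub>R v) - \<Phi> x) /\<^sub>R t) \<longlongrightarrow> (fst v, \<chi> i. G' i x v p)) (at 0)"
          using tendsto_Pair by (fastforce simp: \<Phi>_def)
        moreover have "((\<lambda>t. \<Phi> (x + t *\<^sub>R v)) \<longlongrightarrow> \<Phi> x) (at 0)"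
        proof (rule continuous_on_tendsto_compose[OF cont tendsto_line])
          show "x \<in> X" using x interior_subset by auto
          show "\<forall>\<^sub>F t in at 0. x + t *\<^sub>R v \<in> X"
            using topological_tendstoD[OF tendsto_line open_interior x]
            by (rule eventually_mono) (use interior_subset in \<open>blast\<close>)
        qed
        ultimately have "((\<lambda>t. H (\<Phi> (x + t *\<^sub>R v)) p) has_real_derivative
            H' (\<Phi> x) (fst v, \<chi> i. G' i x v p) p) (at 0)"
          using has_dir_deriv_on_compose[where \<Phi> = \<Phi> and x = x and S = "interior X",
              OF H(3)[of p] open_interior \<Phi>x H'p] by blast
        then show "((\<lambda>t. H (\<Phi> (x + t *\<^sub>R v)) p) has_real_derivative
            H' (\<Phi> x) (fst v, 0) p + (\<Sum>j\<in>UNIV. G' j x v p * H' (\<Phi> x) (0, axis j 1) p)) (at 0)"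
          by (subst (asm) linear_prod_vec_expand[OF lin]) simp
      qed
    qed
  qed
qed


section \<open>Comparison with Bastiani $C^r$-maps\<close>

text \<open>Allows passing between arbitrary sequences of directions and the extensional tuples that
  form the carrier of \<open>power_top k\<close>.\<close>

lemma iter_dir_deriv_param_cong:
  assumes "\<And>i. 1 \<le> i \<Longrightarrow> i \<le> k \<Longrightarrow> y i = y' i"
  shows "iter_dir_deriv k f x y = iter_dir_deriv k f x y'"
  using assms
proof (induction k arbitrary: x)
  case (Suc k)
  have "(\<lambda>x'. iter_dir_deriv k f x' y) = (\<lambda>x'. iter_dir_deriv k f x' y')"
    using Suc by (intro ext Suc.IH) auto
  moreover have "y (Suc k) = y' (Suc k)" using Suc.prems by auto
  ultimately show ?case by simp
qed simp

section \<open>Vector-valued derivatives and their components\<close>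

lemma dir_deriv_tendsto:
  assumes "dir_differentiable f x v"
  shows "((\<lambda>t. (f (x + t *\<^sub>R v) - f x) /\<^sub>R t) \<longlongrightarrow> dir_deriv f x v) (at 0)"
proof -
  obtain l where l: "((\<lambda>t. (f (x + t *\<^sub>R v) - f x) /\<^sub>R t) \<longlongrightarrow> l) (at 0)"
    using assms by (auto simp: dir_differentiable_def)
  then have "dir_deriv f x v = l"
    unfolding dir_deriv_def by (intro tendsto_Lim) auto
  then show ?thesis using l by simp
qed

lemma has_dir_deriv_on_imp_vec:
  fixes g :: "'a::locally_convex_space \<Rightarrow> real ^ 'n"
  assumes h: "\<And>i. has_dir_deriv_on (h i) (h' i) S" and S: "open S" "x \<in> S"
    and eq: "\<And>x i. x \<in> S \<Longrightarrow> g x $ i = h i x"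
  shows "dir_differentiable g x v" and "dir_deriv g x v $ i = h' i x v"
proof -
  have *: "((\<lambda>t. (g (x + t *\<^sub>R v) - g x) /\<^sub>R t) \<longlongrightarrow> (\<chi> i. h' i x v)) (at 0)"
  proof (rule vec_tendstoI)
    fix i
    have "((\<lambda>t. (h i (x + t *\<^sub>R v) - h i x) / t) \<longlongrightarrow> h' i x v) (at 0)"
      using has_dir_deriv_onD[OF h S(2)] by (simp add: has_field_derivative_iff)
    moreover have "\<forall>\<^sub>F t in at 0. (h i (x + t *\<^sub>R v) - h i x) / t = ((g (x + t *\<^sub>R v) - g x) /\<^sub>R t) $ i"
      using topological_tendstoD[OF tendsto_line[of x v] S]
      by eventually_elim (simp add: eq S(2) divide_inverse_commute)
    ultimately show "((\<lambda>t. ((g (x + t *\<^sub>R v) - g x) /\<^sub>R t) $ i) \<longlongrightarrow> (\<chi> i. h' i x v) $ i) (at 0)"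
      by (simp only: vec_lambda_beta) (rule Lim_transform_eventually)
  qed
  then show d: "dir_differentiable g x v" by (auto simp: dir_differentiable_def)
  from tendsto_unique[OF _ dir_deriv_tendsto[OF this] *]
  show "dir_deriv g x v $ i = h' i x v" by simp
qed

lemma has_dir_deriv_on_vec_nth:
  fixes g :: "'a::locally_convex_space \<Rightarrow> real ^ 'n"
  assumes S: "open S" and g: "\<And>x v. x \<in> S \<Longrightarrow> dir_differentiable g x v"
    and eq: "\<And>x. x \<in> S \<Longrightarrow> h x = g x $ i"
    and eq': "\<And>x v. x \<in> S \<Longrightarrow> h' x v = dir_deriv g x v $ i"
  shows "has_dir_deriv_on h h' S"
  unfolding has_dir_deriv_on_def
proof (intro ballI allI)
  fix x v assume x: "x \<in> S"
  have "((\<lambda>t. ((g (x + t *\<^sub>R v) - g x) /\<^sub>R t) $ i) \<longlongrightarrow> h' x v) (at 0)"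
    unfolding eq'[OF x] using dir_deriv_tendsto[OF g[OF x]] by (rule tendsto_vec_nth)
  moreover have "\<forall>\<^sub>F t in at 0. ((g (x + t *\<^sub>R v) - g x) /\<^sub>R t) $ i = (h (x + t *\<^sub>R v) - h x) / t"
    using topological_tendstoD[OF tendsto_line[of x v] S x]
    by eventually_elim (simp add: eq x divide_inverse_commute)
  ultimately have "((\<lambda>t. (h (x + t *\<^sub>R v) - h x) / t) \<longlongrightarrow> h' x v) (at 0)"
    by (rule Lim_transform_eventually)
  then show "((\<lambda>t. h (x + t *\<^sub>R v)) has_real_derivative h' x v) (at 0)"
    by (simp add: has_field_derivative_iff)
qed

section \<open>The topology on tuples of directions\<close>

lemma jointly_continuous_iff_continuous_map:
  "jointly_continuous X H \<longleftrightarrow>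
     continuous_map (prod_topology (top_of_set X) euclidean) euclidean (\<lambda>(x, p). H x p)"
  for H :: "'a::topological_space \<Rightarrow> 'p::topological_space \<Rightarrow> 'b::topological_space"
  using prod_topology_subtopology_eu[of X "UNIV :: 'p set"] by (simp add: jointly_continuous_def)

text \<open>The inclusion of extensional tuples into all sequences is continuous: coordinates in
  \<open>{1..k}\<close> are projections, and every other coordinate is constantly
  \<open>undefined\<close> on the carrier of \<open>power_top k\<close>.\<close>

lemma continuous_map_power_top_jointly_continuous:
  fixes H :: "'a::topological_space \<Rightarrow> (nat \<Rightarrow> 'b::topological_space) \<Rightarrow> 'c::topological_space"
  assumes "jointly_continuous X H"
  shows "continuous_map (prod_topology (top_of_set X) (power_top k)) euclidean (\<lambda>(x, y). H x y)"
proof -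
  have "continuous_map (power_top k) (product_topology (\<lambda>_. euclidean) UNIV) (\<lambda>y :: nat \<Rightarrow> 'b. y)"
    unfolding continuous_map_componentwise_UNIV
  proof
    fix i
    show "continuous_map (power_top k) euclidean (\<lambda>y :: nat \<Rightarrow> 'b. y i)"
    proof (cases "i \<in> {1..k}")
      case True
      then show ?thesis unfolding power_top_def by (rule continuous_map_product_projection)
    next
      case False
      have eq: "undefined = y i" if "y \<in> topspace (power_top k)" for y :: "nat \<Rightarrow> 'b"
        using that False unfolding power_top_def by (auto simp: PiE_def extensional_def)
      have "continuous_map (power_top k) euclidean (\<lambda>y :: nat \<Rightarrow> 'b. undefined :: 'b)" by simp
      from continuous_map_eq[OF this eq] show ?thesis .
    qed
  qed
  then have "continuous_map (power_top k) euclidean (\<lambda>y :: nat \<Rightarrow> 'b. y)"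
    by (simp only: euclidean_product_topology)
  then have "continuous_map (prod_topology (top_of_set X) (power_top k)) (prod_topology (top_of_set X) euclidean)
      (\<lambda>(x, y :: nat \<Rightarrow> 'b). (x, y))"
    by (intro iffD2[OF continuous_map_prod_top]) auto
  moreover have "continuous_map (prod_topology (top_of_set X) euclidean) euclidean (\<lambda>(x, y). H x y)"
    using assms by (simp only: jointly_continuous_iff_continuous_map)
  ultimately have "continuous_map (prod_topology (top_of_set X) (power_top k)) euclidean
      ((\<lambda>(x, y). H x y) \<circ> (\<lambda>(x, y). (x, y)))"
    by (rule continuous_map_compose)
  then show ?thesis by (simp add: o_def case_prod_unfold)
qed

text \<open>The directions are supplied as continuous functions of an arbitrary parameter;
  \<open>restrict\<close> moves the resulting sequence into the carrier of
  \<open>power_top k\<close>.\<close>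

lemma jointly_continuous_power_top:
  assumes h: "continuous_map (prod_topology (top_of_set X) (power_top k)) euclidean h"
    and \<delta>: "\<And>i. continuous_on UNIV (\<delta> i)"
  shows "jointly_continuous X (\<lambda>x p. h (x, restrict (\<lambda>i. \<delta> i p) {1..k}))"
proof -
  have "continuous_map euclidean (power_top k) (\<lambda>p. restrict (\<lambda>i. \<delta> i p) {1..k})"
    unfolding power_top_def by (auto simp: continuous_map_componentwise \<delta>)
  then have "continuous_map (prod_topology (top_of_set X) euclidean) (prod_topology (top_of_set X) (power_top k))
      (\<lambda>(x, p). (x, restrict (\<lambda>i. \<delta> i p) {1..k}))"
    by (intro iffD2[OF continuous_map_prod_top]) auto
  from continuous_map_compose[OF this h]
  have "continuous_map (prod_topology (top_of_set X) euclidean) euclidean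
    (\<lambda>(x, p). h (x, restrict (\<lambda>i. \<delta> i p) {1..k}))"
    by (simp add: o_def case_prod_unfold)
  then show ?thesis by (simp only: jointly_continuous_iff_continuous_map)
qed

text \<open>The extensions \<open>h k\<close>, evaluated at directions that depend continuously on
  the parameter, form a family stable under differentiation: one more derivative replaces
  \<open>h k\<close> by \<open>h (Suc k)\<close> and puts the new direction into slot
  \<open>Suc k\<close>.\<close>

lemma Cr_on_imp_param_Ck:
  fixes f :: "'a::locally_convex_space \<Rightarrow> real ^ 'n"
  assumes f: "Cr_on r X f" and k: "enat k \<le> r"
  shows "param_Ck k X (\<lambda>x (p :: 'p::topological_space). f x $ i)"
proof -
  \<comment> \<open>\<open>Cr_on\<close> prescribes the extensions on the interior only. The last
    clause makes the one of order \<open>0\<close> equal to \<open>f\<close> on all of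
    \<open>X\<close>, as the conclusion speaks of \<open>f\<close> itself.\<close>
  have "\<exists>h. enat k \<le> r \<longrightarrow>
      continuous_map (prod_topology (top_of_set X) (power_top k)) euclidean h \<and>
      (\<forall>x\<in>interior X. \<forall>y\<in>topspace (power_top k). h (x, y) = iter_dir_deriv k f x y) \<and>
      (k = 0 \<longrightarrow> h = (\<lambda>(x, y). f x))" for k
  proof (cases "k = 0")
    case True
    have "continuous_map (top_of_set X) euclidean f"
      using f by (simp add: Cr_on_def)
    from continuous_map_compose[OF continuous_map_fst this]
    have "continuous_map (prod_topology (top_of_set X) (power_top k)) euclidean
        (\<lambda>(x, y :: nat \<Rightarrow> 'a). f x)"
      by (simp add: o_def case_prod_unfold)
    then show ?thesis using True by (intro exI[of _ "\<lambda>(x, y). f x"]) simp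
  next
    case False
    then show ?thesis using f unfolding Cr_on_def by blast
  qed
  then have "\<forall>k. \<exists>h. enat k \<le> r \<longrightarrow>
      continuous_map (prod_topology (top_of_set X) (power_top k)) euclidean h \<and>
      (\<forall>x\<in>interior X. \<forall>y\<in>topspace (power_top k). h (x, y) = iter_dir_deriv k f x y) \<and>
      (k = 0 \<longrightarrow> h = (\<lambda>(x, y). f x))"
    by blast
  from choice[OF this] obtain h where h:
    "\<And>k. enat k \<le> r \<Longrightarrow> continuous_map (prod_topology (top_of_set X) (power_top k)) euclidean (h k)"
    "\<And>k x y. enat k \<le> r \<Longrightarrow> x \<in> interior X \<Longrightarrow> y \<in> topspace (power_top k) \<Longrightarrow>
       h k (x, y) = iter_dir_deriv k f x y"
    "enat 0 \<le> r \<Longrightarrow> h 0 = (\<lambda>(x, y). f x)"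
    by blast
  have h2: "h k (x, restrict y {1..k}) = iter_dir_deriv k f x y"
    if "enat k \<le> r" "x \<in> interior X" for k x y
  proof -
    have "h k (x, restrict y {1..k}) = iter_dir_deriv k f x (restrict y {1..k})"
      using that by (intro h(2)) (auto simp: power_top_def)
    also have "\<dots> = iter_dir_deriv k f x y" by (rule iter_dir_deriv_param_cong) auto
    finally show ?thesis .
  qed
  have diff: "dir_differentiable (\<lambda>x'. iter_dir_deriv k f x' y) x v"
    if "enat (Suc k) \<le> r" "x \<in> interior X" for k x y v
  proof -
    \<comment> \<open>\<open>Cr_on_open\<close> speaks of extensional tuples and differentiates in
      the direction of their last entry. Overwriting slot \<open>Suc k\<close> by \<open>v\<close>
      leaves the first \<open>k\<close> directions alone.\<close>
    define y' where "y' = restrict (y(Suc k := v)) {1..Suc k}"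
    have "Cr_on_open r (interior X) f" using f by (simp add: Cr_on_def)
    moreover have "y' \<in> topspace (power_top (Suc k))" by (auto simp: y'_def power_top_def)
    ultimately have "dir_differentiable (\<lambda>x'. iter_dir_deriv k f x' y') x (y' (Suc k))"
      using that by (auto simp: Cr_on_open_def)
    moreover have "(\<lambda>x'. iter_dir_deriv k f x' y') = (\<lambda>x'. iter_dir_deriv k f x' y)"
      by (intro ext iter_dir_deriv_param_cong) (auto simp: y'_def)
    ultimately show ?thesis by (simp add: y'_def)
  qed
  \<comment> \<open>Here \<open>k\<close> counts the derivatives already taken and \<open>m\<close>
    those still available; the sum stays within \<open>r\<close>.\<close>
  have main: "param_Ck m X (\<lambda>x (p::'p). h k (x, restrict (\<lambda>i. \<delta> i p) {1..k}) $ i)"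
    if "enat (m + k) \<le> r" "\<And>i. continuous_on UNIV (\<delta> i)" for m k \<delta>
    using that
  proof (induction m arbitrary: k \<delta>)
    case 0
    have "jointly_continuous X (\<lambda>x p. h k (x, restrict (\<lambda>i. \<delta> i p) {1..k}))"
      by (rule jointly_continuous_power_top) (use 0 h in auto)
    then show ?case
      unfolding param_Ck.simps jointly_continuous_def case_prod_unfold by (rule continuous_on_component)
  next
    case (Suc m)
    have r: "enat (Suc k) \<le> r" "enat k \<le> r"
      using Suc.prems(1) by (auto intro: order_trans[rotated])
    \<comment> \<open>The new direction is absorbed into the parameter \<open>(v, p)\<close>: slot
      \<open>Suc k\<close> reads off \<open>v\<close>, the other slots ignore it.\<close>
    have restr: "restrict ((\<lambda>i. \<delta> i p)(Suc k := v)) {1..Suc k} =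
        restrict (\<lambda>i. ((\<lambda>i (v, p). \<delta> i p)(Suc k := fst)) i (v, p)) {1..Suc k}" for v p
      by (auto simp: fun_eq_iff)
    have \<delta>': "continuous_on UNIV (((\<lambda>i (v, p). \<delta> i p)(Suc k := fst)) i)" for i
      using continuous_on_compose2[OF Suc.prems(2)[of i] continuous_on_snd[OF continuous_on_id]]
      by (auto simp: case_prod_unfold intro: continuous_on_fst continuous_on_id)
    show ?case
    proof (rule param_CkI[where H' =
          "\<lambda>x v p. h (Suc k) (x, restrict ((\<lambda>i. \<delta> i p)(Suc k := v)) {1..Suc k}) $ i"])
      have "jointly_continuous X (\<lambda>x p. h k (x, restrict (\<lambda>i. \<delta> i p) {1..k}))"
        by (rule jointly_continuous_power_top) (use Suc.prems h r in auto)
      then show "jointly_continuous X (\<lambda>x p. h k (x, restrict (\<lambda>i. \<delta> i p) {1..k}) $ i)"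
        unfolding jointly_continuous_def case_prod_unfold by (rule continuous_on_component)
      have "jointly_continuous X (\<lambda>x q. h (Suc k) (x,
          restrict (\<lambda>i. ((\<lambda>i (v, p). \<delta> i p)(Suc k := fst)) i q) {1..Suc k}))"
        by (rule jointly_continuous_power_top) (use \<delta>' h r in auto)
      then have "jointly_continuous X (\<lambda>x (v, p). h (Suc k) (x,
          restrict ((\<lambda>i. \<delta> i p)(Suc k := v)) {1..Suc k}))"
        by (simp only: restr case_prod_unfold prod.collapse)
      then show "jointly_continuous X (\<lambda>x (v, p). h (Suc k) (x,
          restrict ((\<lambda>i. \<delta> i p)(Suc k := v)) {1..Suc k}) $ i)"
        unfolding jointly_continuous_def case_prod_unfold by (rule continuous_on_component)
      show "has_dir_deriv_on (\<lambda>x. h k (x, restrict (\<lambda>i. \<delta> i p) {1..k}) $ i)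
          (\<lambda>x v. h (Suc k) (x, restrict ((\<lambda>i. \<delta> i p)(Suc k := v)) {1..Suc k}) $ i) (interior X)" for p
      proof (rule has_dir_deriv_on_vec_nth[OF open_interior])
        show "dir_differentiable (\<lambda>x. iter_dir_deriv k f x (\<lambda>i. \<delta> i p)) x v" if "x \<in> interior X" for x v
          using diff r that by blast
        show "h k (x, restrict (\<lambda>i. \<delta> i p) {1..k}) $ i = iter_dir_deriv k f x (\<lambda>i. \<delta> i p) $ i"
          if "x \<in> interior X" for x
          using h2[OF r(2) that] by simp
        show "h (Suc k) (x, restrict ((\<lambda>i. \<delta> i p)(Suc k := v)) {1..Suc k}) $ i =
            dir_deriv (\<lambda>x. iter_dir_deriv k f x (\<lambda>i. \<delta> i p)) x v $ i"
          if "x \<in> interior X" for x v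
        proof -
          have "(\<lambda>x. iter_dir_deriv k f x ((\<lambda>i. \<delta> i p)(Suc k := v))) = (\<lambda>x. iter_dir_deriv k f x (\<lambda>i. \<delta> i p))"
            by (intro ext iter_dir_deriv_param_cong) auto
          then show ?thesis
            using h2[OF r(1) that, of "(\<lambda>i. \<delta> i p)(Suc k := v)"] by simp
        qed
      qed
      show "param_Ck m X (\<lambda>x p. h (Suc k) (x, restrict ((\<lambda>i. \<delta> i p)(Suc k := d p)) {1..Suc k}) $ i)"
        if d: "continuous_on UNIV d" for d
      proof -
        have "restrict ((\<lambda>i. \<delta> i p)(Suc k := d p)) {1..Suc k} =
            restrict (\<lambda>i. (\<delta>(Suc k := d)) i p) {1..Suc k}" for p
          by (auto simp: fun_eq_iff)
        moreover have "param_Ck m X (\<lambda>x p. h (Suc k) (x, restrict (\<lambda>i. (\<delta>(Suc k := d)) i p) {1..Suc k}) $ i)"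
          using Suc.prems d by (intro Suc.IH) auto
        ultimately show ?thesis by simp
      qed
    qed
  qed
  have "param_Ck k X (\<lambda>x (p::'p). h 0 (x, restrict (\<lambda>i. 0) {1..0}) $ i)"
    using main[of k 0 "\<lambda>_ _. 0"] k by simp
  moreover have "enat 0 \<le> r" using k by (auto intro: order_trans[rotated])
  ultimately show ?thesis using h(3) by simp
qed

text \<open>With sequences of directions as parameter space, an iterated derivative is a single
  member of the class: the direction of derivative number \<open>Suc j\<close> is
  \<open>p (Suc j)\<close>, a continuous function of the parameter, so \<open>\<delta>\<close> can
  be that coordinate.\<close>

lemma Cr_on_of_param_Ck:
  fixes g :: "'a::locally_convex_space \<Rightarrow> real ^ 'n"
  assumes X: "Cr_domain X"
    and g: "\<And>k i. enat k \<le> r \<Longrightarrow> param_Ck k X (\<lambda>x (p :: nat \<Rightarrow> 'a). g x $ i)"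
  shows "Cr_on r X g"
proof -
  define D where "D j h \<longleftrightarrow>
      (\<forall>x\<in>interior X. \<forall>y i. iter_dir_deriv j g x y $ i = h i x y)" for j h
  have main: "\<exists>h. (\<forall>i. param_Ck (N - j) X (h i)) \<and> D j h" if N: "enat N \<le> r" and "j \<le> N" for N j
    using that(2)
  proof (induction j)
    case 0
    then show ?case
      using g[OF N] by (intro exI[of _ "\<lambda>i x p. g x $ i"]) (auto simp: D_def)
  next
    case (Suc j)
    then obtain h where h: "\<And>i. param_Ck (Suc (N - Suc j)) X (h i)" and D: "D j h"
      by (auto simp: Suc_diff_Suc)
    have "\<forall>i. \<exists>h'. (\<forall>p. has_dir_deriv_on (\<lambda>x. h i x p) (\<lambda>x v. h' x v p) (interior X)) \<and>
        (\<forall>\<delta>. continuous_on UNIV \<delta> \<longrightarrow> param_Ck (N - Suc j) X (\<lambda>x p. h' x (\<delta> p) p))"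
    proof
      fix i
      show "\<exists>h'. (\<forall>p. has_dir_deriv_on (\<lambda>x. h i x p) (\<lambda>x v. h' x v p) (interior X)) \<and>
          (\<forall>\<delta>. continuous_on UNIV \<delta> \<longrightarrow> param_Ck (N - Suc j) X (\<lambda>x p. h' x (\<delta> p) p))"
        using h[of i] unfolding param_Ck.simps by blast
    qed
    then obtain h' where
        h': "\<forall>i. (\<forall>p. has_dir_deriv_on (\<lambda>x. h i x p) (\<lambda>x v. h' i x v p) (interior X)) \<and>
          (\<forall>\<delta>. continuous_on UNIV \<delta> \<longrightarrow> param_Ck (N - Suc j) X (\<lambda>x p. h' i x (\<delta> p) p))"
      by (rule exE[OF choice])
    note h'1 = h'[THEN spec, THEN conjunct1, rule_format]
      and h'2 = h'[THEN spec, THEN conjunct2, rule_format]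
    show ?case
    proof (intro exI conjI allI)
      show "param_Ck (N - Suc j) X (\<lambda>x p. h' i x (p (Suc j)) p)" for i
        by (rule h'2) (rule continuous_on_product_then_coordinatewise[OF continuous_on_id])
      show "D (Suc j) (\<lambda>i x p. h' i x (p (Suc j)) p)"
        unfolding D_def
      proof (intro ballI allI)
        fix x p i assume x: "x \<in> interior X"
        have "dir_deriv (\<lambda>x. iter_dir_deriv j g x p) x (p (Suc j)) $ i = h' i x (p (Suc j)) p"
          by (rule has_dir_deriv_on_imp_vec(2)[OF h'1 open_interior x]) (use D in \<open>simp add: D_def\<close>)
        then show "iter_dir_deriv (Suc j) g x p $ i = h' i x (p (Suc j)) p" by simp
      qed
    qed
  qed
  have diff: "dir_differentiable (\<lambda>x'. iter_dir_deriv k g x' y) x (y (Suc k))"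
    if k: "enat (Suc k) \<le> r" and x: "x \<in> interior X" for k x y
  proof -
    \<comment> \<open>With \<open>N = Suc k\<close> and \<open>j = k\<close>, the functions
      representing the derivative of order \<open>k\<close> still have order one, so one more
      derivative exists.\<close>
    obtain h where h: "\<And>i. param_Ck (Suc 0) X (h i)" and D: "D k h"
      using main[OF k, of k] by auto
    have "\<forall>i. \<exists>h'. \<forall>p. has_dir_deriv_on (\<lambda>x. h i x p) (\<lambda>x v. h' x v p) (interior X)"
    proof
      show "\<exists>h'. \<forall>p. has_dir_deriv_on (\<lambda>x. h i x p) (\<lambda>x v. h' x v p) (interior X)" for i
        using h[of i] unfolding param_Ck.simps by blast
    qed
    then obtain h' where
        h': "\<forall>i p. has_dir_deriv_on (\<lambda>x. h i x p) (\<lambda>x v. h' i x v p) (interior X)"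
      by (rule exE[OF choice])
    note h'1 = h'[rule_format]
    show ?thesis
      by (rule has_dir_deriv_on_imp_vec(1)[OF h'1 open_interior x]) (use D in \<open>simp add: D_def\<close>)
  qed
  have ext: "\<exists>h. continuous_map (prod_topology (top_of_set X) (power_top k)) euclidean h \<and>
      (\<forall>x\<in>interior X. \<forall>y. h (x, y) = iter_dir_deriv k g x y)" if k: "enat k \<le> r" for k
  proof -
    obtain h where h: "\<And>i. param_Ck 0 X (h i)" and D: "D k h"
      using main[OF k, of k] by auto
    have "jointly_continuous X (\<lambda>x p. \<chi> i. h i x p)"
      using h unfolding param_Ck.simps jointly_continuous_def case_prod_unfold
      by (intro continuous_on_vec_lambda)
    from continuous_map_power_top_jointly_continuous[OF this]
    show ?thesis
      using D by (intro exI[of _ "\<lambda>(x, y). \<chi> i. h i x y"]) (auto simp: D_def vec_eq_iff)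
  qed
  have g_cont: "continuous_on X g"
  proof -
    have "enat 0 \<le> r" by (simp add: zero_enat_def[symmetric])
    then have "continuous_on X (\<lambda>x. \<chi> i. g x $ i)"
      using jointly_continuous_slice[OF param_Ck_cont[OF g]] by (intro continuous_on_vec_lambda)
    then show ?thesis by simp
  qed
  show ?thesis
    unfolding Cr_on_def Cr_on_open_def
  proof (intro conjI allI impI ballI X g_cont open_interior continuous_on_subset[OF g_cont] interior_subset)
    fix k assume k: "enat k \<le> r"
    obtain h where h: "continuous_map (prod_topology (top_of_set X) (power_top k)) euclidean h"
      "\<And>x y. x \<in> interior X \<Longrightarrow> h (x, y) = iter_dir_deriv k g x y"
      using ext[OF k] by blast
    show "\<exists>h. continuous_map (prod_topology (top_of_set X) (power_top k)) euclidean h \<and>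
        (\<forall>x\<in>interior X. \<forall>y\<in>topspace (power_top k). h (x, y) = iter_dir_deriv k g x y)"
      using h by blast
    have "continuous_map (subtopology (prod_topology (top_of_set X) (power_top k)) (interior X \<times> UNIV))
        euclidean h"
      using h(1) by (rule continuous_map_from_subtopology)
    then have "continuous_map (prod_topology (top_of_set (interior X)) (power_top k)) euclidean h"
      by (simp add: subtopology_Times subtopology_subtopology inf_absorb2 interior_subset)
    then show "continuous_map (prod_topology (top_of_set (interior X)) (power_top k)) euclidean
        (\<lambda>(x, y). iter_dir_deriv k g x y)"
      by (rule continuous_map_eq) (auto simp: h(2))
  qed (use diff in blast)
qed


section \<open>Implicit differentiation\<close>

text \<open>By Cramer's rule this is coordinate \<open>l\<close> of the solution of the system with
  matrix \<open>A\<close> and right-hand side \<open>b\<close>; determinants are polynomial in their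
  entries.\<close>

lemma param_Ck_cramer:
  fixes A :: "'a::locally_convex_space \<Rightarrow> 'p::topological_space \<Rightarrow> 'n::finite \<Rightarrow> 'n \<Rightarrow> real"
  assumes "\<And>i. param_Ck k X (\<lambda>x p. b x p i)" and "\<And>i j. param_Ck k X (\<lambda>x p. A x p i j)"
    and "\<And>x p. x \<in> X \<Longrightarrow> det (\<chi> i j. A x p i j) \<noteq> 0"
  shows "param_Ck k X (\<lambda>x p. det (\<chi> i j. if j = l then b x p i else A x p i j) *
           inverse (det (\<chi> i j. A x p i j)))"
proof (rule param_Ck_mult)
  show "param_Ck k X (\<lambda>x p. det (\<chi> i j. if j = l then b x p i else A x p i j))"
  proof (rule param_Ck_det)
    show "param_Ck k X (\<lambda>x p. if j = l then b x p i else A x p i j)" for i j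
      using assms(1,2) by (cases "j = l") auto
  qed
  show "param_Ck k X (\<lambda>x p. inverse (det (\<chi> i j. A x p i j)))"
    using assms(2,3) by (intro param_Ck_inverse param_Ck_det) auto
qed

section \<open>Limits, density and continuity of the inverse\<close>

lemma tendsto_det:
  fixes M :: "'a \<Rightarrow> 'n::finite \<Rightarrow> 'n \<Rightarrow> real"
  assumes "\<And>i j. ((\<lambda>t. M t i j) \<longlongrightarrow> L i j) F"
  shows "((\<lambda>t. det (\<chi> i j. M t i j)) \<longlongrightarrow> det (\<chi> i j. L i j)) F"
  unfolding det_def vec_lambda_beta
  by (intro tendsto_sum tendsto_mult tendsto_const tendsto_prod assms)

text \<open>The set where \<open>a\<close> equals \<open>c\<close> is relatively closed. This
  carries identities between derivatives from the interior to boundary points.\<close>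

lemma continuous_on_const_on_dense:
  fixes a :: "'a::topological_space \<Rightarrow> 'b::t1_space"
  assumes "continuous_on X a" and "S \<subseteq> X" and "X \<subseteq> closure S"
    and "\<And>x. x \<in> S \<Longrightarrow> a x = c" and "x \<in> X"
  shows "a x = c"
proof -
  obtain T where T: "closed T" "{x \<in> X. a x = c} = X \<inter> T"
    using continuous_closedin_preimage_constant[OF assms(1), of c] by (auto simp: closedin_closed)
  then have "S \<subseteq> T" using assms by blast
  then have "closure S \<subseteq> T" using T(1) by (rule closure_minimal)
  then show ?thesis using T assms by blast
qed

lemma continuous_on_fibrewise_inverse:
  fixes f :: "'f::topological_space \<times> 'b::real_normed_vector \<Rightarrow> 'b"
  assumes K: "compact K" and f: "continuous_on (U \<times> K) f"
    and inj: "\<And>z. z \<in> U \<Longrightarrow> inj_on (\<lambda>x. f (z, x)) K"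
    and g: "\<And>z y. z \<in> U \<Longrightarrow> y \<in> K \<Longrightarrow> g (z, y) \<in> K \<and> f (z, g (z, y)) = y"
  shows "continuous_on (U \<times> K) g"
proof (rule iffD2[OF continuous_on_closed_gen[of g _ K]])
  show "g \<in> U \<times> K \<rightarrow> K" using g by auto
  show "\<forall>C. closedin (top_of_set K) C \<longrightarrow> closedin (top_of_set (U \<times> K)) (U \<times> K \<inter> g -` C)"
  proof (intro allI impI)
    fix C assume C: "closedin (top_of_set K) C"
    \<comment> \<open>The part of the graph of \<open>g\<close> with values in \<open>C\<close>,
      expressed through \<open>f\<close> alone and thus closed before \<open>g\<close> is known to
      be continuous. By injectivity its projection along the last factor is the preimage of
      \<open>C\<close>.\<close>
    define R where "R = {q \<in> (U \<times> K) \<times> K. f (fst (fst q), snd q) - snd (fst q) = 0} \<inter>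
      {q \<in> (U \<times> K) \<times> K. snd q \<in> C}"
    have "continuous_on ((U \<times> K) \<times> K) (\<lambda>q. f (fst (fst q), snd q) - snd (fst q))"
      by (intro continuous_on_diff continuous_on_compose2[OF f] continuous_on_Pair continuous_on_fst
          continuous_on_snd continuous_on_id) auto
    moreover have "closedin (top_of_set ((U \<times> K) \<times> K)) {q \<in> (U \<times> K) \<times> K. snd q \<in> C}"
      using closedin_continuous_map_preimage[OF continuous_map_snd C, of "top_of_set (U \<times> K)"]
      by (auto simp: topspace_prod_topology)
    ultimately have "closedin (top_of_set ((U \<times> K) \<times> K)) R"
      unfolding R_def by (intro closedin_Int continuous_closedin_preimage_constant)
    moreover have "closed_map (prod_topology (top_of_set (U \<times> K)) (top_of_set K)) (top_of_set (U \<times> K)) fst"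
      using K by (intro Abstract_Topological_Spaces.closed_map_fst) (simp add: compact_space_subtopology)
    ultimately have "closedin (top_of_set (U \<times> K)) (fst ` R)"
      unfolding closed_map_def by simp
    moreover have "fst ` R = U \<times> K \<inter> g -` C"
    proof (intro set_eqI iffI)
      fix q assume "q \<in> fst ` R"
      then obtain z y x where q: "q = (z, y)" "z \<in> U" "y \<in> K" "x \<in> K" "f (z, x) = y" "x \<in> C"
        by (auto simp: R_def)
      then have "g (z, y) = x" using g[of z y] inj[of z] by (auto simp: inj_on_def)
      then show "q \<in> U \<times> K \<inter> g -` C" using q by simp
    next
      fix q assume q: "q \<in> U \<times> K \<inter> g -` C"
      then have "(q, g q) \<in> R" using g by (auto simp: R_def)
      then show "q \<in> fst ` R" by force
    qed
    ultimately show "closedin (top_of_set (U \<times> K)) (U \<times> K \<inter> g -` C)" by simp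
  qed
qed

text \<open>For \<open>z\<close> on the boundary of \<open>U\<close>, \<open>h'\<close> is just an
  extension. At interior \<open>z'\<close> near \<open>z\<close> the mean value theorem keeps the
  difference quotients close to \<open>L\<close>, for a range of \<open>t\<close> independent of
  \<open>z'\<close>; let \<open>z'\<close> tend to \<open>z\<close> with \<open>t\<close> fixed, and
  only then \<open>t\<close> to \<open>0\<close>.\<close>

lemma has_derivative_slice:
  fixes h :: "'f::locally_convex_space \<times> 'b::real_normed_vector \<Rightarrow> real"
  assumes U: "U \<subseteq> closure (interior U)"
    and h: "continuous_on (U \<times> K) h" "has_dir_deriv_on h h' (interior (U \<times> K))"
    and h': "jointly_continuous (U \<times> K) h'"
    and z: "z \<in> U" and x: "x \<in> interior K"
  shows "((\<lambda>t. h (z, x + t *\<^sub>R v)) has_real_derivative h' (z, x) (0, v)) (at 0)"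
proof -
  define L where "L = h' (z, x) (0, v)"
  define Q where "Q t z = (h (z, x + t *\<^sub>R v) - h (z, x)) / t" for t z
  have "(Q' \<longlongrightarrow> L) (at 0)" if Q': "Q' = (\<lambda>t. Q t z)" for Q'
  proof (rule tendstoI)
    \<comment> \<open>The bound survives the limit in \<open>z'\<close> only as a weak inequality,
      so it is proved with \<open>e/2\<close>.\<close>
    fix e :: real assume e: "e > 0"
    have "continuous_on (U \<times> K) (\<lambda>q. h' q (0, v))"
      using h' by (rule jointly_continuous_slice)
    moreover have "open (ball L (e/2))" "h' (z, x) (0, v) \<in> ball L (e/2)"
      using e by (auto simp: L_def)
    moreover have "(z, x) \<in> U \<times> K" using z x interior_subset by auto
    ultimately obtain A where A: "open A" "(z, x) \<in> A"
        "\<And>q. q \<in> U \<times> K \<Longrightarrow> q \<in> A \<Longrightarrow> h' q (0, v) \<in> ball L (e/2)"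
      unfolding continuous_on_topological by metis
    obtain A1 A2 where A12: "open A1" "open A2" "(z, x) \<in> A1 \<times> A2" "A1 \<times> A2 \<subseteq> A"
      using A(1,2) by (rule open_prod_elim)
    obtain W where W: "open W" "convex W" "x \<in> W" "W \<subseteq> A2 \<inter> interior K"
      using ex_open_convex_subset[of "A2 \<inter> interior K" x] A12 x by auto
    have near: "\<bar>Q t z' - L\<bar> \<le> e/2"
      if t: "t \<noteq> 0" "x + t *\<^sub>R v \<in> W" and z': "z' \<in> interior U" "z' \<in> A1" for t z'
    proof -
      have sub: "{z'} \<times> W \<subseteq> interior (U \<times> K)" using z' W(4) by (auto simp: interior_Times)
      with h(2) have "has_dir_deriv_on h h' ({z'} \<times> W)"
        by (rule has_dir_deriv_on_subset)
      moreover have "convex ({z'} \<times> W)" using W(2) by (intro convex_Times) auto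
      ultimately obtain s where s: "0 \<le> s" "s \<le> 1"
        "h (z', x + t *\<^sub>R v) - h (z', x) =
          h' ((z', x) + s *\<^sub>R ((z', x + t *\<^sub>R v) - (z', x))) ((z', x + t *\<^sub>R v) - (z', x))"
        using has_dir_deriv_on_mvt[of h h' "{z'} \<times> W" "(z', x)" "(z', x + t *\<^sub>R v)"] t W(3) by auto
      define \<xi> where "\<xi> = (z', x + (s * t) *\<^sub>R v)"
      have "(1 - s) *\<^sub>R x + s *\<^sub>R (x + t *\<^sub>R v) \<in> W"
        using s t W by (intro convexD) auto
      then have \<xi>W: "x + (s * t) *\<^sub>R v \<in> W" by (simp add: algebra_simps)
      then have \<xi>: "\<xi> \<in> interior (U \<times> K)" "\<xi> \<in> A" "\<xi> \<in> U \<times> K"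
        using sub z' W(4) A12(4) interior_subset[of "U \<times> K"] by (auto simp: \<xi>_def)
      have "h (z', x + t *\<^sub>R v) - h (z', x) = h' \<xi> (t *\<^sub>R (0, v))"
        using s(3) by (simp add: \<xi>_def)
      then have "Q t z' = h' \<xi> (0, v)"
        using has_dir_deriv_on_scaleR[OF h(2) \<xi>(1), of t "(0, v)"] t(1) by (simp add: Q_def)
      then show ?thesis using A(3)[OF \<xi>(3,2)] by (simp add: dist_real_def abs_minus_commute)
    qed
    have "\<bar>Q t z - L\<bar> \<le> e/2" if t: "t \<noteq> 0" "x + t *\<^sub>R v \<in> W" for t
    \<comment> \<open>If the first factor is the zero space, \<open>z\<close> is an isolated
      interior point and cannot be approached; the limit argument is therefore confined to points
      outside the interior, which are limit points by density.\<close>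
    proof (cases "z \<in> interior U")
      case True
      then show ?thesis using near[OF t] A12(3) by simp
    next
      case False
      then have "z islimpt interior U" using U z by (auto simp: closure_def)
      then have nontriv: "at z within interior U \<noteq> bot" by (simp add: trivial_limit_within)
      have slice: "((\<lambda>z'. h (z', y)) \<longlongrightarrow> h (z, y)) (at z within interior U)" if "y \<in> K" for y
      proof (rule continuous_on_tendsto_compose[OF h(1)])
        show "((\<lambda>z'. (z', y)) \<longlongrightarrow> (z, y)) (at z within interior U)"
          by (intro tendsto_Pair tendsto_const tendsto_ident_at)
        show "\<forall>\<^sub>F z' in at z within interior U. (z', y) \<in> U \<times> K"
          using that interior_subset[of U] by (auto simp: eventually_at_topological)
      qed (use z that in auto)
      have "x + t *\<^sub>R v \<in> K" "x \<in> K" using t W interior_subset by auto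
      then have "((\<lambda>z'. \<bar>Q t z' - L\<bar>) \<longlongrightarrow> \<bar>Q t z - L\<bar>) (at z within interior U)"
        unfolding Q_def using t by (intro tendsto_intros slice) auto
      moreover have "\<forall>\<^sub>F z' in at z within interior U. \<bar>Q t z' - L\<bar> \<le> e/2"
        unfolding eventually_at_topological
        using near[OF t] A12 by (intro exI[of _ A1]) auto
      ultimately show ?thesis by (rule tendsto_upperbound) (rule nontriv)
    qed
    moreover have "\<forall>\<^sub>F t in at 0. x + t *\<^sub>R v \<in> W"
      using W by (intro topological_tendstoD[OF tendsto_line[of x v]])
    moreover have "\<forall>\<^sub>F t::real in at 0. t \<noteq> 0" by (simp add: eventually_at_filter)
    ultimately have "\<forall>\<^sub>F t in at 0. \<bar>Q t z - L\<bar> \<le> e/2"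
      by (auto elim: eventually_elim2)
    then show "\<forall>\<^sub>F t in at 0. dist (Q' t) L < e"
      by eventually_elim (use e in \<open>simp add: Q' dist_real_def\<close>)
  qed
  then show ?thesis
    by (simp add: has_field_derivative_iff Q_def L_def)
qed

text \<open>The quotient of increments solves a linear system whose rows are taken at mean value
  points. Cramer's rule turns convergence of these points into convergence of the quotient.\<close>

lemma implicit_dir_deriv:
  fixes f :: "'f::locally_convex_space \<times> (real ^ 'n) \<Rightarrow> real ^ 'n"
    and g :: "'f \<times> (real ^ 'n) \<Rightarrow> real ^ 'n"
  defines "\<Phi> \<equiv> \<lambda>q. (fst q, g q)"
  assumes S: "open S" "q \<in> S" and f: "\<And>i. has_dir_deriv_on (\<lambda>x. f x $ i) (f' i) S"
    and f': "\<And>i. continuous_on (S \<times> UNIV) (\<lambda>(x, v). f' i x v)"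
    and \<Phi>: "continuous_on S \<Phi>" "\<Phi> \<in> S \<rightarrow> S"
    and inv: "\<And>q. q \<in> S \<Longrightarrow> f (\<Phi> q) = snd q"
    and det: "det (\<chi> i j. f' i (\<Phi> q) (0, axis j 1)) \<noteq> 0"
  shows "((\<lambda>t. g (q + t *\<^sub>R v) $ k) has_real_derivative
      det (\<chi> i j. if j = k then snd v $ i - f' i (\<Phi> q) (fst v, 0) else f' i (\<Phi> q) (0, axis j 1)) *
      inverse (det (\<chi> i j. f' i (\<Phi> q) (0, axis j 1)))) (at 0)"
proof -
  define b where "b = \<Phi> q"
  define c where "c t = \<Phi> (q + t *\<^sub>R v)" for t :: real
  have b: "b \<in> S" using \<Phi>(2) S by (auto simp: b_def)
  have ev_S: "\<forall>\<^sub>F t in at 0. q + t *\<^sub>R v \<in> S"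
    using S by (intro topological_tendstoD[OF tendsto_line[of q v]])
  have c: "(c \<longlongrightarrow> b) (at 0)"
    unfolding c_def b_def by (rule continuous_on_tendsto_compose[OF \<Phi>(1) tendsto_line S(2) ev_S])
  obtain V where V: "open V" "convex V" "b \<in> V" "V \<subseteq> S"
    using ex_open_convex_subset[OF S(1) b] by blast
  have fV: "has_dir_deriv_on (\<lambda>x. f x $ i) (f' i) V" for i
    using f V(4) by (rule has_dir_deriv_on_subset)
  \<comment> \<open>The mean value theorem is for real-valued functions, so each component
    \<open>i\<close> has its own intermediate point; all of them tend to \<open>b\<close>.\<close>
  define P where "P i t s \<longleftrightarrow> 0 \<le> s \<and> s \<le> 1 \<and>
      f (c t) $ i - f b $ i = f' i (b + s *\<^sub>R (c t - b)) (c t - b)" for i t s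
  define s where "s i t = (SOME s. P i t s)" for i t
  define \<xi> where "\<xi> i t = b + s i t *\<^sub>R (c t - b)" for i t
  have P: "\<forall>\<^sub>F t in at 0. P i t (s i t)" for i
    using topological_tendstoD[OF c V(1,3)]
  proof eventually_elim
    case (elim t)
    then have "\<exists>s. P i t s" unfolding P_def using has_dir_deriv_on_mvt[OF fV V(2,3)] by blast
    then show ?case unfolding s_def by (rule someI_ex)
  qed
  have \<xi>: "(\<xi> i \<longlongrightarrow> b) (at 0)" for i
    unfolding \<xi>_def using P[of i] by (intro tendsto_segment tendsto_const c) (auto simp: P_def elim: eventually_mono)
  have ev_\<xi>: "\<forall>\<^sub>F t in at 0. \<xi> i t \<in> S" for i
    by (rule topological_tendstoD[OF \<xi> S(1) b])
  have lim: "((\<lambda>t. f' i (\<xi> i t) w) \<longlongrightarrow> f' i b w) (at 0)" for i w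
  proof -
    have "((\<lambda>t. (\<lambda>(x, v). f' i x v) (\<xi> i t, w)) \<longlongrightarrow> (\<lambda>(x, v). f' i x v) (b, w)) (at 0)"
      by (rule continuous_on_tendsto_compose[OF f'])
        (use b in \<open>auto intro!: tendsto_Pair \<xi> tendsto_const eventually_mono[OF ev_\<xi>]\<close>)
    then show ?thesis by simp
  qed
  define A where "A t = (\<chi> i j. f' i (\<xi> i t) (0, axis j 1))" for t
  define r where "r t i = snd v $ i - f' i (\<xi> i t) (fst v, 0)" for t i
  \<comment> \<open>Convergence of \<open>e t\<close> is the claim, so nothing about it may be
    assumed: it enters only as the solution of a system whose coefficients converge by continuity of
    \<open>\<Phi>\<close>.\<close>
  define e where "e t = (g (q + t *\<^sub>R v) - g q) /\<^sub>R t" for t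
  have lim_A: "((\<lambda>t. det (A t)) \<longlongrightarrow> det (\<chi> i j. f' i b (0, axis j 1))) (at 0)"
    unfolding A_def by (intro tendsto_det lim)
  have lim_b: "((\<lambda>t. det (\<chi> i j. if j = k then r t i else A t $ i $ j)) \<longlongrightarrow>
      det (\<chi> i j. if j = k then snd v $ i - f' i b (fst v, 0) else f' i b (0, axis j 1))) (at 0)"
  proof (rule tendsto_det)
    show "((\<lambda>t. if j = k then r t i else A t $ i $ j) \<longlongrightarrow>
        (if j = k then snd v $ i - f' i b (fst v, 0) else f' i b (0, axis j 1))) (at 0)" for i j
      unfolding A_def r_def using lim by (auto intro!: tendsto_diff)
  qed
  have ne: "\<forall>\<^sub>F t in at 0. det (A t) \<noteq> 0"
    using tendsto_imp_eventually_ne[OF lim_A] det by (simp add: b_def)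
  have "\<forall>\<^sub>F t in at 0. \<forall>i\<in>UNIV. P i t (s i t) \<and> \<xi> i t \<in> S"
    using P ev_\<xi> by (intro eventually_ball_finite ballI eventually_conj) auto
  moreover have "\<forall>\<^sub>F t::real in at 0. t \<noteq> 0" by (simp add: eventually_at_filter)
  ultimately have "\<forall>\<^sub>F t in at 0. det (\<chi> i j. if j = k then r t i else A t $ i $ j) * inverse (det (A t)) =
      (g (q + t *\<^sub>R v) $ k - g q $ k) / t"
    using ne ev_S
  proof eventually_elim
    case (elim t)
    have diff: "c t - b = t *\<^sub>R (fst v, e t)"
      using elim by (simp add: c_def b_def \<Phi>_def e_def)
    have "(A t *v e t) $ i = r t i" for i
    proof -
      have \<xi>S: "\<xi> i t \<in> S" and eq: "f (c t) $ i - f b $ i = f' i (\<xi> i t) (c t - b)"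
        using elim by (auto simp: P_def \<xi>_def)
      \<comment> \<open>Composing \<open>f\<close> with \<open>\<Phi>\<close> gives
        \<open>snd\<close>, so this increment is known exactly.\<close>
      have "f (c t) $ i - f b $ i = t * snd v $ i"
        using inv elim S by (simp add: c_def b_def)
      moreover have "f' i (\<xi> i t) (c t - b) = t * f' i (\<xi> i t) (fst v, e t)"
        unfolding diff by (rule has_dir_deriv_on_scaleR[OF f \<xi>S])
      ultimately have "snd v $ i = f' i (\<xi> i t) (fst v, e t)"
        using eq elim by simp
      also have "\<dots> = f' i (\<xi> i t) (fst v, 0) + (\<Sum>j\<in>UNIV. e t $ j * f' i (\<xi> i t) (0, axis j 1))"
        by (rule linear_prod_vec_expand[OF has_dir_deriv_on_linear[OF f S(1) \<xi>S f']])
      finally show ?thesis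
        by (simp add: r_def A_def matrix_vector_mult_def mult.commute)
    qed
    then have "A t *v e t = (\<chi> i. r t i)" by (simp add: vec_eq_iff)
    then have "e t = (\<chi> k. det (\<chi> i j. if j = k then (\<chi> i. r t i) $ i else A t $ i $ j) / det (A t))"
      using cramer elim by blast
    then have "e t $ k = det (\<chi> i j. if j = k then r t i else A t $ i $ j) * inverse (det (A t))"
      by (simp only: vec_lambda_beta divide_inverse)
    then show ?case by (simp add: e_def divide_inverse_commute)
  qed
  moreover have "((\<lambda>t. det (\<chi> i j. if j = k then r t i else A t $ i $ j) * inverse (det (A t))) \<longlongrightarrow>
      det (\<chi> i j. if j = k then snd v $ i - f' i b (fst v, 0) else f' i b (0, axis j 1)) *
      inverse (det (\<chi> i j. f' i b (0, axis j 1)))) (at 0)"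
    using det by (intro tendsto_mult tendsto_inverse lim_A lim_b) (simp add: b_def)
  ultimately have "((\<lambda>t. (g (q + t *\<^sub>R v) $ k - g q $ k) / t) \<longlongrightarrow>
      det (\<chi> i j. if j = k then snd v $ i - f' i b (fst v, 0) else f' i b (0, axis j 1)) *
      inverse (det (\<chi> i j. f' i b (0, axis j 1)))) (at 0)"
    by (rule Lim_transform_eventually[rotated])
  then show ?thesis unfolding has_field_derivative_iff b_def by simp
qed


section \<open>Fibrewise inverses\<close>

text \<open>Differentiating \<open>\<psi> (f (z, x)) = x\<close> in \<open>x\<close> gives a left inverse of the partial derivative
  on the interior; the identity persists on the boundary by density.\<close>

lemma partial_derivative_det_nonzero:
  fixes f :: "'f::locally_convex_space \<times> (real ^ 'n) \<Rightarrow> real ^ 'n" and \<psi> :: "real ^ 'n \<Rightarrow> real ^ 'n"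
  assumes dense: "U \<subseteq> closure (interior U)" "K \<subseteq> closure (interior K)"
    and f: "continuous_on (U \<times> K) f"
    and f': "\<And>i. has_dir_deriv_on (\<lambda>x. f x $ i) (f' i) (interior (U \<times> K))"
      "\<And>i. jointly_continuous (U \<times> K) (f' i)"
    and z: "z \<in> U" and x: "x \<in> K"
    and \<psi>: "Cr_on 1 K \<psi>" "\<And>x. x \<in> K \<Longrightarrow> \<psi> (f (z, x)) = x"
    and maps: "\<And>x. x \<in> K \<Longrightarrow> f (z, x) \<in> K" "\<And>x. x \<in> interior K \<Longrightarrow> f (z, x) \<in> interior K"
  shows "det (\<chi> i j. f' i (z, x) (0, axis j 1)) \<noteq> 0"
proof -
  have "\<exists>\<psi>'. jointly_continuous K \<psi>' \<and> has_dir_deriv_on (\<lambda>y. \<psi> y $ i) \<psi>' (interior K)" for i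
  proof -
    \<comment> \<open>The real parameter is a dummy, frozen at \<open>0\<close> below.\<close>
    have "param_Ck (Suc 0) K (\<lambda>x (p :: real). \<psi> x $ i)"
      by (rule Cr_on_imp_param_Ck[OF \<psi>(1)]) (simp add: one_enat_def)
    then obtain H' where H': "jointly_continuous K (\<lambda>x (v, p :: real). H' x v p)"
        "\<And>p. has_dir_deriv_on (\<lambda>x. \<psi> x $ i) (\<lambda>x v. H' x v p) (interior K)"
      unfolding param_Ck.simps by blast
    have "continuous_on UNIV (\<lambda>v :: real ^ 'n. (v, 0 :: real))"
      by (intro continuous_on_Pair continuous_on_id continuous_on_const)
    from jointly_continuous_param[OF H'(1) this] H'(2)[of 0] show ?thesis by auto
  qed
  then obtain \<psi>' where \<psi>': "\<And>i. jointly_continuous K (\<psi>' i)"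
      "\<And>i. has_dir_deriv_on (\<lambda>y. \<psi> y $ i) (\<psi>' i) (interior K)"
    by metis
  have \<psi>'_cont: "continuous_on (interior K \<times> UNIV) (\<lambda>(y, v). \<psi>' i y v)" for i
    using jointly_continuous_subset[OF \<psi>'(1) interior_subset] by (simp add: jointly_continuous_def)
  have f'_cont: "continuous_on (interior (U \<times> K) \<times> UNIV) (\<lambda>(x, v). f' i x v)" for i
    using jointly_continuous_subset[OF f'(2) interior_subset] by (simp add: jointly_continuous_def)
  have fz: "continuous_on K (\<lambda>x. f (z, x))"
    by (intro continuous_on_compose2[OF f] continuous_on_Pair continuous_on_const continuous_on_id)
      (use z in auto)
  define L where "L x v = (\<chi> i. f' i (z, x) (0, v))" for x v
  have L_cont: "continuous_on K (\<lambda>x. L x v)" for v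
    unfolding L_def
    by (intro continuous_on_vec_lambda continuous_on_compose2[OF jointly_continuous_slice[OF f'(2)]]
        continuous_on_Pair continuous_on_const continuous_on_id) (use z in auto)
  have left_inverse: "\<psi>' i (f (z, x)) (L x v) = v $ i" for i v
  proof -
    have "\<psi>' i (f (z, x)) (L x v) - v $ i = 0"
    proof (rule continuous_on_const_on_dense[OF _ interior_subset dense(2) _ x])
      show "continuous_on K (\<lambda>x. \<psi>' i (f (z, x)) (L x v) - v $ i)"
        by (intro continuous_on_diff continuous_on_const
            continuous_on_compose2[OF \<psi>'(1)[unfolded jointly_continuous_def], where f = "\<lambda>x. (f (z, x), L x v)", simplified]
            continuous_on_Pair fz L_cont) (use maps in auto)
    next
      fix x assume x: "x \<in> interior K"
      \<comment> \<open>Here \<open>x\<close> is interior but \<open>z\<close> may lie on the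
        boundary of \<open>U\<close>, so differentiability in \<open>x\<close> comes from the slice
        lemma.\<close>
      have "((\<lambda>t. (f (z, x + t *\<^sub>R v) $ j - f (z, x) $ j) / t) \<longlongrightarrow> f' j (z, x) (0, v)) (at 0)" for j
        using has_derivative_slice[OF dense(1) continuous_on_component[OF f] f' z x]
        by (simp add: has_field_derivative_iff)
      then have u: "((\<lambda>t. (f (z, x + t *\<^sub>R v) - f (z, x)) /\<^sub>R t) \<longlongrightarrow> L x v) (at 0)"
        unfolding L_def by (intro vec_tendstoI) (simp add: divide_inverse_commute)
      have ev: "\<forall>\<^sub>F t in at 0. x + t *\<^sub>R v \<in> interior K"
        using x by (intro topological_tendstoD[OF tendsto_line[of x v]]) auto
      have "((\<lambda>t. f (z, x + t *\<^sub>R v)) \<longlongrightarrow> f (z, x)) (at 0)"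
        by (rule continuous_on_tendsto_compose[OF fz tendsto_line])
          (use x ev interior_subset in \<open>auto elim!: eventually_mono\<close>)
      from has_dir_deriv_on_compose[where \<Phi> = "\<lambda>x. f (z, x)", OF \<psi>'(2) open_interior maps(2)[OF x] \<psi>'_cont this u]
      have "((\<lambda>t. (\<psi> (f (z, x + t *\<^sub>R v)) $ i - \<psi> (f (z, x)) $ i) / t) \<longlongrightarrow> \<psi>' i (f (z, x)) (L x v)) (at 0)"
        by (simp add: has_field_derivative_iff)
      moreover have "\<forall>\<^sub>F t in at 0. (\<psi> (f (z, x + t *\<^sub>R v)) $ i - \<psi> (f (z, x)) $ i) / t = v $ i"
      proof -
        have "\<forall>\<^sub>F t::real in at 0. t \<noteq> 0" by (simp add: eventually_at_filter)
        with ev show ?thesis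
        proof eventually_elim
          case (elim t)
          then have "x + t *\<^sub>R v \<in> K" "x \<in> K" using x interior_subset by auto
          then show ?case using elim by (simp add: \<psi>(2))
        qed
      qed
      ultimately have "((\<lambda>t::real. v $ i) \<longlongrightarrow> \<psi>' i (f (z, x)) (L x v)) (at 0)"
        by (rule Lim_transform_eventually)
      then show "\<psi>' i (f (z, x)) (L x v) - v $ i = 0"
        by (simp add: tendsto_const_iff)
    qed
    then show ?thesis by simp
  qed
  \<comment> \<open>Together with \<open>left_inverse\<close> this makes the kernel trivial:
    \<open>L x v = 0\<close> forces every \<open>v $ i\<close> to vanish.\<close>
  have \<psi>'_0: "\<psi>' i y 0 = 0" if "y \<in> K" for i y
  proof (rule continuous_on_const_on_dense[OF jointly_continuous_slice[OF \<psi>'(1)] interior_subset dense(2) _ that])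
    show "\<psi>' i y 0 = 0" if "y \<in> interior K" for y
      using has_dir_deriv_on_scaleR[OF \<psi>'(2) that, of i 0 0] by simp
  qed
  \<comment> \<open>Linearity over the interior extends to \<open>(z, x)\<close> by density and
    identifies \<open>L x\<close> with multiplication by the matrix of partial derivatives.\<close>
  have expand: "f' i (z, x) (0, v) = (\<Sum>j\<in>UNIV. v $ j * f' i (z, x) (0, axis j 1))" for i v
  proof -
    have "f' i (z, x) (0, v) - (\<Sum>j\<in>UNIV. v $ j * f' i (z, x) (0, axis j 1)) = 0"
    proof (rule continuous_on_const_on_dense[of "U \<times> K" _ "interior (U \<times> K)"])
      show "continuous_on (U \<times> K) (\<lambda>q. f' i q (0, v) - (\<Sum>j\<in>UNIV. v $ j * f' i q (0, axis j 1)))"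
        by (intro continuous_on_diff continuous_on_sum continuous_on_mult continuous_on_const
            jointly_continuous_slice[OF f'(2)])
      show "U \<times> K \<subseteq> closure (interior (U \<times> K))"
        using dense by (auto simp: interior_Times closure_Times)
      show "f' i q (0, v) - (\<Sum>j\<in>UNIV. v $ j * f' i q (0, axis j 1)) = 0" if "q \<in> interior (U \<times> K)" for q
      proof -
        have lin: "linear (f' i q)"
          by (rule has_dir_deriv_on_linear[OF f'(1) open_interior that f'_cont])
        show ?thesis
          using linear_prod_vec_expand[OF lin, of 0 v] linear_0[OF lin] by (simp add: zero_prod_def)
      qed
    qed (use z x interior_subset in auto)
    then show ?thesis by simp
  qed
  define A where "A = (\<chi> i j. f' i (z, x) (0, axis j 1))"
  have "v = 0" if "A *v v = 0" for v
  proof -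
    have "A *v v = L x v"
      by (simp add: vec_eq_iff matrix_vector_mult_def A_def L_def expand[of _ v] mult.commute)
    then have "v $ i = 0" for i
      using left_inverse[of i v] \<psi>'_0[OF maps(1)[OF x]] that by simp
    then show ?thesis by (simp add: vec_eq_iff)
  qed
  then have "invertible A"
    by (simp add: invertible_left_inverse matrix_left_invertible_ker)
  then show ?thesis by (simp add: invertible_det_nz A_def)
qed

text \<open>If \<open>\<phi> x\<close> lies in the frontier, then \<open>\<phi>\<close> fixes it, so
  injectivity gives \<open>\<phi> x = x\<close>. A closed set is the disjoint union of its interior
  and its frontier.\<close>

lemma fixing_frontier_interior:
  assumes "closed K" and "inj_on \<phi> K" and "\<phi> \<in> K \<rightarrow> K" and "\<And>x. x \<in> frontier K \<Longrightarrow> \<phi> x = x" and "x \<in> K"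
  shows "\<phi> x \<in> interior K \<longleftrightarrow> x \<in> interior K"
proof -
  have K: "y \<in> interior K \<longleftrightarrow> y \<notin> frontier K" if "y \<in> K" for y
    using that assms(1) by (auto simp: frontier_def)
  have "frontier K \<subseteq> K" using assms(1) by (rule frontier_subset_closed)
  then have "\<phi> x \<in> frontier K \<longleftrightarrow> x \<in> frontier K"
    using assms by (metis inj_onD subsetD)
  then show ?thesis using K assms by blast
qed

theorem theoremC:
  fixes K :: "(real ^ 'n) set"
    and U :: "'f::locally_convex_space set"
    and f :: "'f \<times> (real ^ 'n) \<Rightarrow> real ^ 'n"
    and r :: enat
  assumes "compact K" and "convex K" and "interior K \<noteq> {}"
    and "convex U" and "interior U \<noteq> {}"
    and "r \<ge> 1"
    and "Cr_map r (U \<times> K) K f"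
    and "\<And>z. z \<in> U \<Longrightarrow> (\<lambda>x\<in>K. f (z, x)) \<in> Diff_fixing_frontier r K"
  shows "Cr_map r (U \<times> K) K (\<lambda>(z, y). inv_into K (\<lambda>x\<in>K. f (z, x)) y)"
proof -
  define X where "X = U \<times> K"
  define \<psi> where "\<psi> z = inv_into K (\<lambda>x\<in>K. f (z, x))" for z
  define g where "g q = \<psi> (fst q) (snd q)" for q
  define \<Phi> where "\<Phi> q = (fst q, g q)" for q
  have f_Cr: "Cr_on r X f" and f_K: "f \<in> X \<rightarrow> K"
    using assms(7) by (auto simp: Cr_map_def X_def)
  have frontier_K: "frontier K \<subseteq> K"
    using assms(1) by (intro frontier_subset_closed compact_imp_closed)
  have bij: "bij_betw (\<lambda>x\<in>K. f (z, x)) K K" and \<psi>_Cr: "Cr_on r K (\<psi> z)" if "z \<in> U" for z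
    using assms(8)[OF that] unfolding Diff_fixing_frontier_def Cr_map_def \<psi>_def by blast+
  have front: "f (z, x) = x" if "z \<in> U" "x \<in> frontier K" for z x
  proof -
    have "(\<lambda>x\<in>K. f (z, x)) x = x"
      using assms(8)[OF that(1)] that(2) unfolding Diff_fixing_frontier_def by blast
    then show ?thesis using frontier_K that(2) by (simp add: subset_iff)
  qed
  have inj: "inj_on (\<lambda>x. f (z, x)) K" if "z \<in> U" for z
    using bij[OF that] by (auto simp: bij_betw_def inj_on_def)
  have \<psi>_K: "\<psi> z y \<in> K" and f_\<psi>: "f (z, \<psi> z y) = y" if "z \<in> U" "y \<in> K" for z y
  proof -
    have "y \<in> (\<lambda>x\<in>K. f (z, x)) ` K" using bij[OF that(1)] that(2) by (simp only: bij_betw_def)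
    then show "\<psi> z y \<in> K" "f (z, \<psi> z y) = y"
      using inv_into_into[of y "\<lambda>x\<in>K. f (z, x)" K] f_inv_into_f[of y "\<lambda>x\<in>K. f (z, x)" K]
      by (simp_all add: \<psi>_def)
  qed
  have \<psi>_f: "\<psi> z (f (z, x)) = x" if "z \<in> U" "x \<in> K" for z x
    using \<psi>_K[OF that(1)] f_\<psi>[OF that(1)] inj[OF that(1)] that f_K
    by (auto simp: inj_on_def X_def Pi_iff)
  have int: "f (z, x) \<in> interior K \<longleftrightarrow> x \<in> interior K" if "z \<in> U" "x \<in> K" for z x
    using fixing_frontier_interior[OF compact_imp_closed[OF assms(1)] inj[OF that(1)] _ front[OF that(1)] that(2)]
      f_K that by (auto simp: X_def)
  have \<Phi>: "\<Phi> \<in> X \<rightarrow> X" "\<Phi> \<in> interior X \<rightarrow> interior X"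
  proof -
    show 1: "\<Phi> \<in> X \<rightarrow> X" using \<psi>_K by (auto simp: \<Phi>_def g_def X_def)
    show "\<Phi> \<in> interior X \<rightarrow> interior X"
    proof
      fix q assume q: "q \<in> interior X"
      then have "fst q \<in> interior U" "snd q \<in> interior K" "fst q \<in> U" "snd q \<in> K"
        using interior_subset[of U] interior_subset[of K] by (auto simp: X_def interior_Times)
      then show "\<Phi> q \<in> interior X"
        using int[of "fst q" "g q"] \<psi>_K f_\<psi> by (auto simp: \<Phi>_def g_def X_def interior_Times)
    qed
  qed
  have f_\<Phi>: "f (\<Phi> q) = snd q" if "q \<in> X" for q
    using f_\<psi> that by (auto simp: \<Phi>_def g_def X_def)
  have dense: "U \<subseteq> closure (interior U)" "K \<subseteq> closure (interior K)"
    using Cr_domain_convex assms by (auto simp: Cr_domain_def)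
  have X: "Cr_domain X"
    unfolding X_def using assms by (intro Cr_domain_convex convex_Times) (auto simp: interior_Times)
  have f_cont: "continuous_on X f" using f_Cr by (simp add: Cr_on_def)
  have g_cont: "continuous_on X g"
    unfolding X_def
    by (rule continuous_on_fibrewise_inverse[OF assms(1) f_cont[unfolded X_def] inj])
      (auto simp: g_def \<psi>_K f_\<psi>)
  have \<Phi>_cont: "continuous_on X \<Phi>"
    unfolding \<Phi>_def by (intro continuous_on_Pair continuous_on_fst continuous_on_id g_cont)
  \<comment> \<open>The parameter space is the space of direction sequences that
    \<open>Cr_on_of_param_Ck\<close> asks for.\<close>
  have main: "param_Ck m X (\<lambda>x (p :: nat \<Rightarrow> 'f \<times> (real ^ 'n)). g x $ i)" if "enat m \<le> r" for m i
    using that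
  proof (induction m arbitrary: i)
    case 0
    show ?case
      unfolding param_Ck.simps jointly_continuous_def case_prod_unfold
      by (intro continuous_on_component continuous_on_compose2[OF g_cont] continuous_on_fst continuous_on_id) auto
  next
    case (Suc m)
    have "enat m \<le> r" by (rule order_trans[OF _ Suc.prems]) simp
    then have g_m: "param_Ck m X (\<lambda>x (p :: nat \<Rightarrow> 'f \<times> (real ^ 'n)). g x $ i)" for i
      by (rule Suc.IH)
    have f_m: "param_Ck (Suc m) X (\<lambda>x (p :: nat \<Rightarrow> 'f \<times> (real ^ 'n)). f x $ i)" for i
      by (rule Cr_on_imp_param_Ck[OF f_Cr Suc.prems])
    have "\<forall>i. \<exists>f'. jointly_continuous X (\<lambda>x (v, p :: nat \<Rightarrow> 'f \<times> (real ^ 'n)). f' x v p) \<and>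
        (\<forall>p. has_dir_deriv_on (\<lambda>x. f x $ i) (\<lambda>x v. f' x v p) (interior X)) \<and>
        (\<forall>\<delta>. continuous_on UNIV \<delta> \<longrightarrow> param_Ck m X (\<lambda>x p. f' x (\<delta> p) p))"
      using f_m unfolding param_Ck.simps by (intro allI) blast
    then obtain f' where
      f': "\<forall>i. jointly_continuous X (\<lambda>x (v, p :: nat \<Rightarrow> 'f \<times> (real ^ 'n)). f' i x v p) \<and>
        (\<forall>p. has_dir_deriv_on (\<lambda>x. f x $ i) (\<lambda>x v. f' i x v p) (interior X)) \<and>
        (\<forall>\<delta>. continuous_on UNIV \<delta> \<longrightarrow> param_Ck m X (\<lambda>x p. f' i x (\<delta> p) p))"
      by (rule exE[OF choice])
    note f'1 = f'[THEN spec, THEN conjunct1]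
      and f'2 = f'[THEN spec, THEN conjunct2, THEN conjunct1, rule_format]
      and f'3 = f'[THEN spec, THEN conjunct2, THEN conjunct2, rule_format]
    have f'p: "jointly_continuous X (\<lambda>x v. f' i x v p)" for i p
    proof -
      have "continuous_on UNIV (\<lambda>v :: 'f \<times> (real ^ 'n). (v, p))"
        by (intro continuous_on_Pair continuous_on_id continuous_on_const)
      from jointly_continuous_param[OF f'1 this] show ?thesis by simp
    qed
    \<comment> \<open>Wanted on all of \<open>X\<close>, since the extended derivative of
      \<open>g\<close> divides by this determinant. \<open>f'\<close> formally carries a parameter;
      each fixed \<open>p\<close> gives first derivatives of \<open>f\<close>.\<close>
    have det: "det (\<chi> i j. f' i (\<Phi> q) (0, axis j 1) p) \<noteq> 0" if q: "q \<in> X" for q p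
    proof -
      have z: "fst q \<in> U" and y: "g q \<in> K" using q \<Phi>(1) by (auto simp: X_def \<Phi>_def)
      have "Cr_on 1 K (\<psi> (fst q))"
        using \<psi>_Cr[OF z] assms(6) unfolding Cr_on_def Cr_on_open_def
        by (auto intro: order_trans)
      moreover have "f (fst q, x) \<in> interior K" if "x \<in> interior K" for x
        using int[OF z] interior_subset[of K] that by blast
      moreover have "f (fst q, x) \<in> K" if "x \<in> K" for x
        using f_K z that by (auto simp: X_def)
      ultimately show ?thesis
        using partial_derivative_det_nonzero[OF dense f_cont[unfolded X_def] f'2[unfolded X_def, of _ p]
            f'p[unfolded X_def, of _ p] z y _ \<psi>_f[OF z]]
        by (simp add: \<Phi>_def)
    qed
    show ?case
    \<comment> \<open>The witness is coordinate \<open>i\<close> of the solution \<open>u\<close> of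
      \<open>f' (\<Phi> x) (fst v, u) = snd v\<close>, obtained by differentiating
      \<open>f (\<Phi> x) = snd x\<close> in the direction \<open>v\<close>.\<close>
    proof (rule param_CkI[where H' = "\<lambda>x v p.
          det (\<chi> k j. if j = i then snd v $ k - f' k (\<Phi> x) (fst v, 0) p else f' k (\<Phi> x) (0, axis j 1) p) *
          inverse (det (\<chi> k j. f' k (\<Phi> x) (0, axis j 1) p))"])
      show "jointly_continuous X (\<lambda>x (p :: nat \<Rightarrow> 'f \<times> (real ^ 'n)). g x $ i)"
        using param_Ck_cont[OF g_m] .
      have jc: "jointly_continuous X (\<lambda>x q. f' k (\<Phi> x) (d (fst q)) (snd q))" if d: "continuous_on UNIV d" for k d
      proof -
        have "continuous_on UNIV (\<lambda>q. (d (fst q), snd q) :: _ \<times> (nat \<Rightarrow> 'f \<times> (real ^ 'n)))"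
          by (intro continuous_on_Pair continuous_on_compose2[OF d] continuous_on_fst
              continuous_on_snd continuous_on_id) auto
        from jointly_continuous_base[OF jointly_continuous_param[OF f'1 this] \<Phi>_cont \<Phi>(1)]
        show ?thesis by (simp add: case_prod_unfold)
      qed
      \<comment> \<open>Joint continuity in \<open>x\<close>, \<open>v\<close> and \<open>p\<close>
        is the order \<open>0\<close> case of the closure lemma, with the pair of \<open>v\<close>
        and \<open>p\<close> as parameter.\<close>
      have "param_Ck 0 X (\<lambda>x q. (\<lambda>v p.
          det (\<chi> k j. if j = i then snd v $ k - f' k (\<Phi> x) (fst v, 0) p else f' k (\<Phi> x) (0, axis j 1) p) *
          inverse (det (\<chi> k j. f' k (\<Phi> x) (0, axis j 1) p))) (fst q) (snd q))"
      proof (rule param_Ck_cramer[where b = "\<lambda>x q k. snd (fst q) $ k - f' k (\<Phi> x) (fst (fst q), 0) (snd q)"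
            and A = "\<lambda>x q k j. f' k (\<Phi> x) (0, axis j 1) (snd q)"])
        have "jointly_continuous X (\<lambda>x q. f' k (\<Phi> x) (fst (fst q), 0) (snd q))" for k
          using jc[of "\<lambda>v. (fst v, 0)"]
          by (simp add: continuous_on_Pair continuous_on_fst continuous_on_const continuous_on_id)
        then show "param_Ck 0 X (\<lambda>x q. snd (fst q) $ k - f' k (\<Phi> x) (fst (fst q), 0) (snd q))" for k
          unfolding param_Ck.simps jointly_continuous_def case_prod_unfold
          by (intro continuous_on_diff continuous_on_component continuous_on_snd continuous_on_fst continuous_on_id)
        show "param_Ck 0 X (\<lambda>x q. f' k (\<Phi> x) (0, axis j 1) (snd q))" for k j
          using jc[OF continuous_on_const] by simp
      qed (use det in auto)
      then show "jointly_continuous X (\<lambda>x (v, p).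
          det (\<chi> k j. if j = i then snd v $ k - f' k (\<Phi> x) (fst v, 0) p else f' k (\<Phi> x) (0, axis j 1) p) *
          inverse (det (\<chi> k j. f' k (\<Phi> x) (0, axis j 1) p)))"
        by (simp only: param_Ck.simps case_prod_unfold)
      \<comment> \<open>The gain of an order: \<open>f'\<close> is of order \<open>m\<close> because
        \<open>f\<close> is of order \<open>Suc m\<close>, and \<open>g\<close> is needed at order
        \<open>m\<close> only.\<close>
      have comp: "param_Ck m X (\<lambda>x p. f' k (\<Phi> x) (\<delta> p) p)" if "continuous_on UNIV \<delta>" for k \<delta>
        using param_Ck_compose_snd[OF f'3[OF that] g_m] \<Phi> unfolding \<Phi>_def by blast
      show "param_Ck m X (\<lambda>x p.
          det (\<chi> k j. if j = i then snd (\<delta> p) $ k - f' k (\<Phi> x) (fst (\<delta> p), 0) p else f' k (\<Phi> x) (0, axis j 1) p) *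
          inverse (det (\<chi> k j. f' k (\<Phi> x) (0, axis j 1) p)))"
        if \<delta>: "continuous_on UNIV \<delta>" for \<delta>
      proof (rule param_Ck_cramer[OF _ comp[OF continuous_on_const] det])
        fix k
        have "param_Ck m X (\<lambda>x p. snd (\<delta> p) $ k)"
          by (intro param_Ck_of_param continuous_on_component continuous_on_snd \<delta>)
        moreover have "param_Ck m X (\<lambda>x p. (-1) * f' k (\<Phi> x) (fst (\<delta> p), 0) p)"
        proof (rule param_Ck_mult)
          show "param_Ck m X (\<lambda>x p. -1)" by (rule param_Ck_of_param) (rule continuous_on_const)
          show "param_Ck m X (\<lambda>x p. f' k (\<Phi> x) (fst (\<delta> p), 0) p)"
            by (rule comp) (intro continuous_on_Pair continuous_on_fst continuous_on_const \<delta>)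
        qed
        ultimately have "param_Ck m X (\<lambda>x p. snd (\<delta> p) $ k + (-1) * f' k (\<Phi> x) (fst (\<delta> p), 0) p)"
          by (rule param_Ck_add)
        then show "param_Ck m X (\<lambda>x p. snd (\<delta> p) $ k - f' k (\<Phi> x) (fst (\<delta> p), 0) p)" by simp
      qed
      show "has_dir_deriv_on (\<lambda>x. g x $ i) (\<lambda>x v.
          det (\<chi> k j. if j = i then snd v $ k - f' k (\<Phi> x) (fst v, 0) p else f' k (\<Phi> x) (0, axis j 1) p) *
          inverse (det (\<chi> k j. f' k (\<Phi> x) (0, axis j 1) p))) (interior X)" for p
        unfolding has_dir_deriv_on_def
      proof (intro ballI allI)
        fix q v assume q: "q \<in> interior X"
        then have qX: "q \<in> X" using interior_subset by auto
        have cont: "continuous_on (interior X \<times> UNIV) (\<lambda>(x, v). f' i x v p)" for i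
          using jointly_continuous_subset[OF f'p interior_subset] by (simp add: jointly_continuous_def)
        show "((\<lambda>t. g (q + t *\<^sub>R v) $ i) has_real_derivative
            det (\<chi> k j. if j = i then snd v $ k - f' k (\<Phi> q) (fst v, 0) p else f' k (\<Phi> q) (0, axis j 1) p) *
            inverse (det (\<chi> k j. f' k (\<Phi> q) (0, axis j 1) p))) (at 0)"
          unfolding \<Phi>_def
        proof (rule implicit_dir_deriv[OF open_interior q f'2 cont])
          show "continuous_on (interior X) (\<lambda>q. (fst q, g q))"
            using continuous_on_subset[OF \<Phi>_cont interior_subset] by (simp add: \<Phi>_def)
          show "(\<lambda>q. (fst q, g q)) \<in> interior X \<rightarrow> interior X"
            using \<Phi>(2) by (simp add: \<Phi>_def[abs_def])
          show "f (fst q, g q) = snd q" if "q \<in> interior X" for q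
            using f_\<Phi>[of q] that interior_subset[of X] by (auto simp: \<Phi>_def)
          show "det (\<chi> i j. f' i (fst q, g q) (0, axis j 1) p) \<noteq> 0"
            using det[OF qX] by (simp add: \<Phi>_def)
        qed
      qed
    qed
  qed
  have "Cr_map r X K g"
    unfolding Cr_map_def
  proof
    show "g \<in> X \<rightarrow> K" using \<psi>_K by (auto simp: g_def X_def)
    show "Cr_on r X g" by (rule Cr_on_of_param_Ck[OF X main])
  qed
  then show ?thesis
    by (simp add: X_def g_def[abs_def] \<psi>_def case_prod_unfold)
qed

end
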